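(* Let $r,m,n$ be integers with $0\le r<m\le n$, and let $1\le i\le m$, $1\le j\le n$. Then the random vector $(X_{i:m},X_{j:n}^{(r)})$ has a density with respect to the measure $\nu$, given by $$f_{X_{i:m},X_{j:n}^{(r)}}(x,y)=\sum_{k,\ell=1}^{n+r}p_{r,(i,m,k),(j,n,\ell)}\,f_{k,\ell:n+r}(x,y),$$ where, with $|A|=r$, $|B|=m-r$, $|C|=n+r-m$, the coefficients $p_{r,(i,m,k),(j,n,\ell)}=\mathbb{P}(X_{i:m}=X_{k:n+r},\,X_{j:n}^{(r)}=X_{\ell:n+r})$ are zero unless $i\le k\le i+n+r-m$ and $j\le \ell\le j+r$, and are given by: (i) for $k<\ell$, $$p_{r,(i,m,k),(j,n,\ell)}=\frac{(n-j+1)\left(|A|\,\mathfrak{D}_{|A|-1,|B|,|C|,k-1,\ell-k-1,k-i,\ell-j-1}+|B|\,\mathfrak{D}_{|A|,|B|-1,|C|,k-1,\ell-k-1,k-i,\ell-j}\right)}{(r+n-\ell+1)\,(r+n)!};$$ (ii) for $k=\ell$, $$p_{r,(i,m,k),(j,n,k)}=\frac{|B|\,\mathfrak{D}_{|A|,|B|-1,|C|,k-1,0,k-i,k-j}}{(r+n)!};$$ (iii) for $k>\ell$, $$p_{r,(i,m,k),(j,n,\ell)}=\frac{(m-i+1)\left(|C|\,\mathfrak{D}_{|C|-1,|B|,|A|,\ell-1,k-\ell-1,\ell-j,k-i-1}+|B|\,\mathfrak{D}_{|C|,|B|-1,|A|,\ell-1,k-\ell-1,\ell-j,k-i}\right)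}{(r+n-k+1)\,(r+n)!}.$$
   Context: $X_1,X_2,\ldots$ are independent identically distributed real random variables whose common distribution is absolutely continuous with respect to Lebesgue measure, with density $f$. $X_{i:m}$ is the $i$-th smallest among $X_1,\ldots,X_m$ (so $X_{1:m}\le\cdots\le X_{m:m}$), and $X_{j:n}^{(r)}$ is the $j$-th smallest among $X_{r+1},\ldots,X_{r+n}$. The measure $\nu$ on $\mathbb{R}^2$ is $\nu(S)=\mu_2(S)+\mu_1(\{x\in\mathbb{R}:(x,x)\in S\})$ for Borel $S\subset\mathbb{R}^2$, where $\mu_d$ is Lebesgue measure on $\mathbb{R}^d$. For $N\ge1$ and $1\le k,\ell\le N$: $f_{k:N}$ is the density of $X_{k:N}$; if $k\ne\ell$, $f_{k,\ell:N}$ is the density of $(X_{k:N},X_{\ell:N})$ with respect to $\mu_2$, in a version with $f_{k,\ell:N}(s,s)=0$ for all $s$; if $k=\ell$, $f_{k,k:N}(s,t)=f_{k:N}(s)\,\delta_{s,t}$ with $\delta_{s,t}$ the Kronecker delta. In each case $f_{k,\ell:N}$ is a density of $(X_{k:N},X_{\ell:N})$ with respect to $\nu$. For integers $r,s,t,k,\ell\ge0$ with $k+\ell\le N:=r+s+t$ and integers $i,j$, $$\mathfrak{D}_{r,s,t,k,\ell,i,j}=\frac{N!}{\binom{N}{k,\ell}}\binom{t}{i}\binom{r}{j}\sum_{m=\max\{0,j-\ell\}}^{\min\{j,k-i\}}\binom{j}{m}\binom{s}{k-i-m}\binom{s+t+m-k}{\ell+m-j},$$ where $\binom{N}{k,\ell}=\frac{N!}{k!\,\ell!\,(N-k-\ell)!}$,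 $\binom{a}{b}=0$ if $b<0$ or $a<b$, and an empty sum is $0$. (In this definition the letters $r,s,t,k,\ell,i,j,m$ are dummy parameters.) A product $|A|\,\mathfrak{D}_{|A|-1,\ldots}$ with $|A|=0$, or $|C|\,\mathfrak{D}_{|C|-1,\ldots}$ with $|C|=0$, is interpreted as $0$. *)

theory Defs
  imports "HOL-Probability.Probability"
begin

text \<open>
  \<open>order_stat X i m\<close> is $X_{i:m}$, for \<open>1 \<le> i \<le> m\<close>.  The sequence is indexed from 1 (the value
  \<open>X 0\<close> is never used), so the shifted order statistic $X_{j:n}^{(r)}$ of $X_{r+1},\ldots,X_{r+n}$ is
  \<open>order_stat (\<lambda>p. X (r + p)) j n\<close>.
\<close>

definition order_stat :: "(nat \<Rightarrow> 'a \<Rightarrow> real) \<Rightarrow> nat \<Rightarrow> nat \<Rightarrow> 'a \<Rightarrow> real" where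
  "order_stat X i m \<omega> = sort (map (\<lambda>p. X p \<omega>) [1..<m + 1]) ! (i - 1)"

abbreviation shifted_order_stat ::
  "(nat \<Rightarrow> 'a \<Rightarrow> real) \<Rightarrow> nat \<Rightarrow> nat \<Rightarrow> nat \<Rightarrow> 'a \<Rightarrow> real" where
  "shifted_order_stat X r j n \<equiv> order_stat (\<lambda>p. X (r + p)) j n"

text \<open>The measure \<open>\<nu>\<close>; that the set function below really is a measure is shown in \<open>emeasure_nu\<close>.\<close>

definition nu :: "(real \<times> real) measure" where
  "nu = measure_of UNIV (sets borel)
     (\<lambda>S. emeasure lborel S + emeasure lborel {x::real. (x, x) \<in> S})"

lemma space_nu [simp]: "space nu = UNIV"
  by (simp add: nu_def space_measure_of_conv)

lemma sets_nu [simp, measurable_cong]: "sets nu = sets borel"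
  unfolding nu_def using sets.sigma_sets_eq[of "borel :: (real \<times> real) measure"]
  by (simp add: sets_measure_of_conv)

lemma emeasure_nu:
  assumes "S \<in> sets borel"
  shows "emeasure nu S = emeasure lborel S + emeasure lborel {x. (x, x) \<in> S}"
proof -
  let ?d = "\<lambda>x::real. (x, x)"
  have d: "?d \<in> measurable lborel borel"
    by (intro borel_measurable_Pair) simp_all
  have diag: "emeasure lborel {x. (x, x) \<in> A} = emeasure (distr lborel borel ?d) A"
    if "A \<in> sets borel" for A :: "(real \<times> real) set"
    using that d by (simp add: emeasure_distr vimage_def)
  have "countably_additive (sets borel)
      (\<lambda>A. emeasure lborel A + emeasure lborel {x::real. (x, x) \<in> A})"
  proof (rule countably_additiveI)
    fix A :: "nat \<Rightarrow> (real \<times> real) set"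
    assume A: "range A \<subseteq> sets borel" "disjoint_family A" "(\<Union>i. A i) \<in> sets borel"
    have "(\<Sum>i. emeasure lborel (A i) + emeasure lborel {x::real. (x, x) \<in> A i})
      = (\<Sum>i. emeasure lborel (A i)) + (\<Sum>i. emeasure lborel {x::real. (x, x) \<in> A i})"
      by (rule suminf_add[symmetric]) auto
    also have "(\<Sum>i. emeasure lborel (A i)) = emeasure lborel (\<Union>i. A i)"
      using A by (intro suminf_emeasure) auto
    also have "(\<Sum>i. emeasure lborel {x::real. (x, x) \<in> A i})
      = (\<Sum>i. emeasure (distr lborel borel ?d) (A i))"
      using A by (intro suminf_cong diag) auto
    also have "\<dots> = emeasure (distr lborel borel ?d) (\<Union>i. A i)"
      using A by (intro suminf_emeasure) auto
    also have "\<dots> = emeasure lborel {x::real. (x, x) \<in> (\<Union>i. A i)}"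
      using A by (intro diag[symmetric]) auto
    finally show "(\<Sum>i. emeasure lborel (A i) + emeasure lborel {x::real. (x, x) \<in> A i})
      = emeasure lborel (\<Union>i. A i) + emeasure lborel {x::real. (x, x) \<in> (\<Union>i. A i)}" .
  qed
  moreover have "positive (sets borel)
      (\<lambda>A. emeasure lborel A + emeasure lborel {x::real. (x, x) \<in> A})"
    by (simp add: positive_def)
  moreover have "sigma_algebra UNIV (sets (borel :: (real \<times> real) measure))"
    using sets.sigma_algebra_axioms[of "borel :: (real \<times> real) measure"] by simp
  ultimately show ?thesis
    unfolding nu_def using assms by (intro emeasure_measure_of_sigma) auto
qed

text \<open>
  \<open>g k\<close> is a version of $f_{k:N}$, and for \<open>k \<noteq> l\<close> \<open>h k l\<close> is a version of $f_{k,l:N}$ that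
  vanishes on the diagonal.
\<close>

definition order_stat_densities ::
  "'a measure \<Rightarrow> (nat \<Rightarrow> 'a \<Rightarrow> real) \<Rightarrow> nat \<Rightarrow> (nat \<Rightarrow> real \<Rightarrow> ennreal)
     \<Rightarrow> (nat \<Rightarrow> nat \<Rightarrow> real \<times> real \<Rightarrow> ennreal) \<Rightarrow> bool" where
  "order_stat_densities M X N g h \<longleftrightarrow>
     (\<forall>k\<in>{1..N}. distributed M lborel (order_stat X k N) (g k)) \<and>
     (\<forall>k\<in>{1..N}. \<forall>l\<in>{1..N}. k \<noteq> l \<longrightarrow>
        distributed M lborel (\<lambda>\<omega>. (order_stat X k N \<omega>, order_stat X l N \<omega>)) (h k l) \<and>
        (\<forall>s. h k l (s, s) = 0))"

definition joint_density ::
  "(nat \<Rightarrow> real \<Rightarrow> ennreal) \<Rightarrow> (nat \<Rightarrow> nat \<Rightarrow> real \<times> real \<Rightarrow> ennreal)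
     \<Rightarrow> nat \<Rightarrow> nat \<Rightarrow> real \<Rightarrow> real \<Rightarrow> ennreal" where
  "joint_density g h k l s t =
     (if k = l then (if s = t then g k s else 0) else h k l (s, t))"

definition coef ::
  "'a measure \<Rightarrow> (nat \<Rightarrow> 'a \<Rightarrow> real) \<Rightarrow> nat \<Rightarrow> nat \<Rightarrow> nat \<Rightarrow> nat \<Rightarrow> nat \<Rightarrow> nat \<Rightarrow> nat \<Rightarrow> real" where
  "coef M X r i m k j n l =
     measure M {\<omega> \<in> space M. order_stat X i m \<omega> = order_stat X k (n + r) \<omega> \<and>
                              shifted_order_stat X r j n \<omega> = order_stat X l (n + r) \<omega>}"

definition zbinom :: "int \<Rightarrow> int \<Rightarrow> nat" where
  "zbinom a b = (if b < 0 \<or> a < b then 0 else nat a choose nat b)"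

text \<open>$\binom{N}{k,l}$, meaningful for \<open>k + l \<le> N\<close>.\<close>

definition trinom :: "nat \<Rightarrow> nat \<Rightarrow> nat \<Rightarrow> real" where
  "trinom N k l = fact N / (fact k * fact l * fact (N - k - l))"

text \<open>
  The lower indices \<open>r\<close>, \<open>s\<close>, \<open>t\<close>, \<open>k\<close>, \<open>l\<close> are nonnegative with \<open>k + l \<le> r + s + t\<close>, whereas
  \<open>i\<close> and \<open>j\<close> may be negative.  In a product \<open>a * DD (a - 1) \<dots>\<close> with \<open>a = 0\<close> the truncated
  difference is harmless, since the product is 0 as it should be.
\<close>

definition DD :: "nat \<Rightarrow> nat \<Rightarrow> nat \<Rightarrow> nat \<Rightarrow> nat \<Rightarrow> int \<Rightarrow> int \<Rightarrow> real" where
  "DD r s t k l i j =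
     (let N = r + s + t in
      fact N / trinom N k l * real (zbinom (int t) i) * real (zbinom (int r) j) *
      (\<Sum>m\<in>{max 0 (j - int l)..min j (int k - i)}.
         real (zbinom j m) * real (zbinom (int s) (int k - i - m)) *
         real (zbinom (int s + int t + m - int k) (int l + m - j))))"

end

theory Submission
  imports Defs "HOL-Combinatorics.Multiset_Permutations"
begin

text \<open>
  Almost surely the \<open>N = n + r\<close> observations are distinct, so exactly one list \<open>ys\<close> of
  the indices \<open>1, \<dots>, N\<close> orders them increasingly, and then $X_{k:N} = X_p$ for the
  \<open>k\<close>-th entry \<open>p\<close> of \<open>ys\<close>.  As the observations are i.i.d., the event that \<open>ys\<close> is
  this list has the same joint law with $(X_{k:N}, X_{l:N})$ for every \<open>ys\<close>.
  Whether $X_{i:m} = X_{k:N}$ and $X_{j:n}^{(r)} = X_{l:N}$ depends only on \<open>ys\<close>.  Hence this event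
  is independent of $(X_{k:N}, X_{l:N})$ and its probability is a number of lists divided by \<open>N!\<close>.
  Splitting a list at the positions \<open>k\<close> and \<open>l\<close> and classifying the indices in each piece
  according to the blocks \<open>A = {1..r}\<close>, \<open>B = {r+1..m}\<close>, \<open>C = {m+1..n+r}\<close> gives this number.
\<close>

section \<open>Counting permutations\<close>

text \<open>The arguments of \<open>DD\<close> count the indices outside a sample. An entry at
  position k with rank i within A \<union> B has i - 1 predecessors there, so k - i of its k - 1
  predecessors lie in C; an entry at position l with rank j within B \<union> C has l - j
  predecessors in A. For k < l the earlier entry is itself a predecessor of the later one. It
  belongs to A \<union> B and is removed from its block before \<open>DD\<close> is used; taken from
  A it accounts for one of the l - j, which gives l - j - 1 in one term and l - j in the other. The
  case k > l is the mirror image with A and C exchanged, and for k = l the entry lies in both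
  samples, hence in B.

  In the density, the terms with k = l are carried by the diagonal, a null set of the plane, and the
  terms with k \<noteq> l are normalised to vanish there, so only one of the two summands of
  \<open>nu\<close> contributes to each term. The absence of ties and the existence of plane
  densities rest on the same fact: two observations with different indices almost surely avoid any
  given null set of the plane.\<close>

lemma card_eq_mult_fibre:
  assumes "finite A" "finite B" "\<And>x. x \<in> A \<Longrightarrow> f x \<in> B"
    and "\<And>y. y \<in> B \<Longrightarrow> card {x \<in> A. f x = y} = c"
  shows "card A = c * card B"
proof -
  have "card A = (\<Sum>y\<in>B. card {x \<in> A. f x = y})"
    using sum.group[of A B f "\<lambda>_. 1::nat"] assms(1-3) by (auto simp: image_subset_iff)
  then show ?thesis using assms(4) by simp
qed

text \<open>Sizes such as k - i may be negative as integers; \<open>zbinom\<close> is 0 there, so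
  the counting below needs no case distinction on signs.\<close>

lemma card_subsets_int:
  assumes "finite X"
  shows "card {R. R \<subseteq> X \<and> int (card R) = z} = zbinom (int (card X)) z"
proof (cases "z < 0")
  case True
  then have "{R. R \<subseteq> X \<and> int (card R) = z} = {}" by auto
  then show ?thesis using True by (simp add: zbinom_def del: Collect_empty_eq)
next
  case False
  then have "{R. R \<subseteq> X \<and> int (card R) = z} = {R. R \<subseteq> X \<and> card R = nat z}" by auto
  then show ?thesis using False n_subsets[OF assms, of "nat z"]
    by (auto simp: zbinom_def intro: binomial_eq_0)
qed

text \<open>The sum over m in \<open>DD\<close> arises here: the remaining choices depend on S
  \<inter> A only through its size m.\<close>

lemma sum_Pow_card:
  fixes F :: "nat \<Rightarrow> nat"
  assumes "finite J"
  shows "(\<Sum>S\<in>Pow J. F (card S)) = (\<Sum>m\<le>card J. (card J choose m) * F m)"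
proof -
  have "(\<Sum>S\<in>Pow J. F (card S)) = (\<Sum>m\<le>card J. \<Sum>S\<in>{S\<in>Pow J. card S = m}. F (card S))"
    using assms by (intro sum.group[symmetric]) (auto intro: card_mono)
  also have "\<dots> = (\<Sum>m\<le>card J. (card J choose m) * F m)"
  proof (rule sum.cong[OF refl])
    fix m
    have "(\<Sum>S\<in>{S\<in>Pow J. card S = m}. F (card S)) = card {S. S \<subseteq> J \<and> card S = m} * F m" by simp
    then show "(\<Sum>S\<in>{S\<in>Pow J. card S = m}. F (card S)) = (card J choose m) * F m"
      using n_subsets[OF assms] by simp
  qed
  finally show ?thesis .
qed

lemma card_Un3_disjoint:
  assumes "finite X" "finite Y" "finite Z" "X \<inter> Y = {}" "X \<inter> Z = {}" "Y \<inter> Z = {}"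
  shows "card (X \<union> Y \<union> Z) = card X + card Y + card Z"
  using assms by (simp add: card_Un_disjoint Int_Un_distrib2)

lemma card_Int_add_Int:
  assumes "finite S" "S \<subseteq> X \<union> Y" "X \<inter> Y = {}"
  shows "card (S \<inter> X) + card (S \<inter> Y) = card S"
proof -
  have "card S = card ((S \<inter> X) \<union> (S \<inter> Y))" using assms(2) by (intro arg_cong[where f = card]) auto
  also have "\<dots> = card (S \<inter> X) + card (S \<inter> Y)" using assms by (intro card_Un_disjoint) auto
  finally show ?thesis by simp
qed

text \<open>Finiteness and cardinality are carried together so that the rule can be applied
  repeatedly to the nested \<open>Sigma\<close> in \<open>card_split_pairs\<close>.\<close>

lemma card_Sigma_sum:
  assumes "finite X" "\<And>x. x \<in> X \<Longrightarrow> finite (Y x) \<and> card (Y x) = F x"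
  shows "finite (Sigma X Y) \<and> card (Sigma X Y) = (\<Sum>x\<in>X. F x)"
  using assms by (simp add: card_SigmaI)

text \<open>
  \<open>S\<close> is the set of the first \<open>a\<close> entries of a permutation of \<open>A \<union> B \<union> C\<close> and \<open>T\<close> the set of
  the next \<open>b\<close> entries; \<open>DD\<close> counts the permutations for which the pair \<open>(S, T)\<close> is as below.
\<close>

definition split_pairs ::
  "'b set \<Rightarrow> 'b set \<Rightarrow> 'b set \<Rightarrow> nat \<Rightarrow> nat \<Rightarrow> int \<Rightarrow> int \<Rightarrow> ('b set \<times> 'b set) set" where
  "split_pairs A B C a b i j =
     {(S, T). S \<subseteq> A \<union> B \<union> C \<and> T \<subseteq> A \<union> B \<union> C \<and> S \<inter> T = {} \<and> card S = a \<and> card T = b \<and>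
              int (card (S \<inter> C)) = i \<and> int (card ((S \<union> T) \<inter> A)) = j}"

lemma finite_split_pairs:
  assumes "finite A" "finite B" "finite C"
  shows "finite (split_pairs A B C a b i j)"
proof (rule finite_subset)
  show "split_pairs A B C a b i j \<subseteq> Pow (A \<union> B \<union> C) \<times> Pow (A \<union> B \<union> C)"
    by (auto simp: split_pairs_def)
qed (use assms in auto)

text \<open>A pair (S, T) is built by five choices: D = S \<inter> C, J = (S \<union> T) \<inter> A,
  A' = S \<inter> A inside J, B' = S \<inter> B, and R = T - A. With m the size of A', the last two
  sets must have a - i - m and b + m - j elements, and each binomial factor of the formula counts
  one of these choices.\<close>

lemma card_split_pairs:
  assumes fin: "finite A" "finite B" "finite C"
    and disj: "A \<inter> B = {}" "A \<inter> C = {}" "B \<inter> C = {}"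
  shows "card (split_pairs A B C a b i j) =
    zbinom (int (card C)) i * zbinom (int (card A)) j *
      (\<Sum>m\<in>{max 0 (j - int b)..min j (int a - i)}.
         zbinom j m * zbinom (int (card B)) (int a - i - m) *
         zbinom (int (card B) + int (card C) + m - int a) (int b + m - j))"
proof -
  let ?F = "\<lambda>m. zbinom (int (card B)) (int a - i - m) *
         zbinom (int (card B) + int (card C) + m - int a) (int b + m - j)"
  define Q where "Q = (SIGMA D:{D. D \<subseteq> C \<and> int (card D) = i}. SIGMA J:{J. J \<subseteq> A \<and> int (card J) = j}.
     SIGMA A':Pow J. SIGMA B':{B'. B' \<subseteq> B \<and> int (card B') = int a - i - int (card A')}.
       {R. R \<subseteq> (B - B') \<union> (C - D) \<and> int (card R) = int b + int (card A') - j})"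
  have finsub: "finite {S. S \<subseteq> Z \<and> Pr S}" if "finite Z" for Z :: "'a set" and Pr
    using finite_Pow_iff[of Z] that by (auto intro!: finite_subset[of "{S. S \<subseteq> Z \<and> Pr S}" "Pow Z"])
  have bij: "bij_betw (\<lambda>(S, T). (S \<inter> C, (S \<union> T) \<inter> A, S \<inter> A, S \<inter> B, T - A)) (split_pairs A B C a b i j) Q"
  proof (rule bij_betw_byWitness[where f' = "\<lambda>(D, J, A', B', R). (A' \<union> B' \<union> D, (J - A') \<union> R)"])
    show "\<forall>x\<in>split_pairs A B C a b i j.
      (case case x of (S, T) \<Rightarrow> (S \<inter> C, (S \<union> T) \<inter> A, S \<inter> A, S \<inter> B, T - A) of
        (D, J, A', B', R) \<Rightarrow> (A' \<union> B' \<union> D, J - A' \<union> R)) = x"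
      using disj by (auto simp: split_pairs_def)
    show "\<forall>x\<in>Q. (case case x of (D, J, A', B', R) \<Rightarrow> (A' \<union> B' \<union> D, J - A' \<union> R) of
        (S, T) \<Rightarrow> (S \<inter> C, (S \<union> T) \<inter> A, S \<inter> A, S \<inter> B, T - A)) = x"
      using disj unfolding Q_def by auto
    show "(\<lambda>(S, T). (S \<inter> C, (S \<union> T) \<inter> A, S \<inter> A, S \<inter> B, T - A)) ` split_pairs A B C a b i j \<subseteq> Q"
    proof clarify
      fix S T assume "(S, T) \<in> split_pairs A B C a b i j"
      then have *: "S \<subseteq> A \<union> B \<union> C" "T \<subseteq> A \<union> B \<union> C" "S \<inter> T = {}" "card S = a" "card T = b"
        "int (card (S \<inter> C)) = i" "int (card ((S \<union> T) \<inter> A)) = j" by (auto simp: split_pairs_def)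
      have f: "finite S" "finite T" using * fin by (meson finite_UnI finite_subset)+
      have S: "S = (S \<inter> A) \<union> (S \<inter> B) \<union> (S \<inter> C)" using * by auto
      have cS: "card S = card (S \<inter> A) + card (S \<inter> B) + card (S \<inter> C)"
        using card_Un3_disjoint[of "S \<inter> A" "S \<inter> B" "S \<inter> C"] S f disj by force
      have cT: "card T = card (T \<inter> A) + card (T - A)"
        using f card_Int_Diff by blast
      have U: "card ((S \<union> T) \<inter> A) = card (S \<inter> A) + card (T \<inter> A)"
        using f * by (subst card_Un_disjoint[symmetric]) (auto intro: arg_cong[where f=card])
      show "(S \<inter> C, (S \<union> T) \<inter> A, S \<inter> A, S \<inter> B, T - A) \<in> Q"
        unfolding Q_def using * cS cT U by auto
    qed
    show "(\<lambda>(D, J, A', B', R). (A' \<union> B' \<union> D, J - A' \<union> R)) ` Q \<subseteq> split_pairs A B C a b i j"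
    proof clarify
      fix D J A' B' R assume "(D, J, A', B', R) \<in> Q"
      then have *: "D \<subseteq> C" "int (card D) = i" "J \<subseteq> A" "int (card J) = j" "A' \<subseteq> J" "B' \<subseteq> B"
        "int (card B') = int a - i - int (card A')" "R \<subseteq> (B - B') \<union> (C - D)"
        "int (card R) = int b + int (card A') - j" unfolding Q_def by auto
      have f: "finite D" "finite J" "finite A'" "finite B'" "finite R"
        using * fin by (meson finite_UnI finite_Diff finite_subset)+
      have "card (A' \<union> B' \<union> D) = card A' + card B' + card D"
        using f * disj by (intro card_Un3_disjoint) blast+
      then have c1: "card (A' \<union> B' \<union> D) = a" using * by linarith
      have "card ((J - A') \<union> R) = (card J - card A') + card R"
        using f * disj by (subst card_Un_disjoint) (blast | simp add: card_Diff_subset)+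
      moreover have "card A' \<le> card J" using f * by (simp add: card_mono)
      ultimately have c2: "card ((J - A') \<union> R) = b" using * by linarith
      have e1: "(A' \<union> B' \<union> D) \<inter> C = D" and e2: "(A' \<union> B' \<union> D \<union> (J - A' \<union> R)) \<inter> A = J"
        using * disj by auto
      show "(A' \<union> B' \<union> D, J - A' \<union> R) \<in> split_pairs A B C a b i j"
        unfolding split_pairs_def mem_Collect_eq case_prod_conv e1 e2
        using * disj c1 c2 by (intro conjI) blast+
    qed
  qed
  \<comment> \<open>R is taken from what S leaves of B \<union> C. With m the size of A', S uses (a
    - i - m) + i = a - m elements there, whatever D and B' are, so the count depends on m
    alone.\<close>
  have R: "card {R. R \<subseteq> (B - B') \<union> (C - D) \<and> int (card R) = int b + int (card A') - j}
      = zbinom (int (card B) + int (card C) + int (card A') - int a) (int b + int (card A') - j)"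
    if "D \<subseteq> C" "int (card D) = i" "B' \<subseteq> B" "int (card B') = int a - i - int (card A')" for D A' B'
  proof -
    have f: "finite D" "finite B'" using that fin by (meson finite_subset)+
    have "card ((B - B') \<union> (C - D)) = (card B - card B') + (card C - card D)"
      using that fin disj f by (subst card_Un_disjoint) (auto simp: card_Diff_subset)
    moreover have "card B' \<le> card B" "card D \<le> card C" using that fin by (simp_all add: card_mono)
    ultimately have "int (card ((B - B') \<union> (C - D))) = int (card B) + int (card C) + int (card A') - int a"
      using that by linarith
    then show ?thesis using card_subsets_int[of "(B - B') \<union> (C - D)"] fin by simp
  qed
  have fJ: "finite J" if "J \<subseteq> A" for J using that fin finite_subset by blast
  have "card Q = (\<Sum>D\<in>{D. D \<subseteq> C \<and> int (card D) = i}. \<Sum>J\<in>{J. J \<subseteq> A \<and> int (card J) = j}.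
     \<Sum>A'\<in>Pow J. \<Sum>B'\<in>{B'. B' \<subseteq> B \<and> int (card B') = int a - i - int (card A')}.
       card {R. R \<subseteq> (B - B') \<union> (C - D) \<and> int (card R) = int b + int (card A') - j})"
    unfolding Q_def
  proof (rule card_Sigma_sum[THEN conjunct2])
    show "finite {D. D \<subseteq> C \<and> int (card D) = i}"
      using fin by (intro finsub)
  qed (rule card_Sigma_sum | rule conjI | rule refl | rule finsub |
       use fin fJ in \<open>simp; fail\<close>)+
  also have "\<dots> = (\<Sum>D\<in>{D. D \<subseteq> C \<and> int (card D) = i}. \<Sum>J\<in>{J. J \<subseteq> A \<and> int (card J) = j}.
     \<Sum>A'\<in>Pow J. ?F (int (card A')))"
  proof (intro sum.cong refl)
    fix D J A' assume D: "D \<in> {D. D \<subseteq> C \<and> int (card D) = i}"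
    let ?B = "{B'. B' \<subseteq> B \<and> int (card B') = int a - i - int (card A')}"
    have "(\<Sum>B'\<in>?B. card {R. R \<subseteq> (B - B') \<union> (C - D) \<and> int (card R) = int b + int (card A') - j}) =
      (\<Sum>B'\<in>?B. zbinom (int (card B) + int (card C) + int (card A') - int a) (int b + int (card A') - j))"
      using D by (intro sum.cong refl R) auto
    then show "(\<Sum>B'\<in>?B. card {R. R \<subseteq> (B - B') \<union> (C - D) \<and> int (card R) = int b + int (card A') - j}) =
      ?F (int (card A'))"
      using card_subsets_int[OF fin(2)] by simp
  qed
  also have "\<dots> = (\<Sum>D\<in>{D. D \<subseteq> C \<and> int (card D) = i}. \<Sum>J\<in>{J. J \<subseteq> A \<and> int (card J) = j}.
     (\<Sum>m\<in>{max 0 (j - int b)..min j (int a - i)}. zbinom j m * ?F m))"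
  proof (intro sum.cong refl)
    fix J assume J: "J \<in> {J. J \<subseteq> A \<and> int (card J) = j}"
    have "finite J" using J fin finite_subset by auto
    then have "(\<Sum>A'\<in>Pow J. ?F (int (card A'))) = (\<Sum>m\<le>card J. (card J choose m) * ?F (int m))"
      using sum_Pow_card[of J "\<lambda>m. ?F (int m)"] by simp
    also have "\<dots> = (\<Sum>m\<in>int ` {..card J}. zbinom j m * ?F m)"
      using J by (subst sum.reindex) (auto simp: zbinom_def intro!: sum.cong)
    also have "int ` {..card J} = {0..j}"
      using J by (auto simp: image_iff intro!: bexI[of _ "nat _"])
    \<comment> \<open>Outside the smaller range a lower index is negative: b + m - j for m < j - b,
      and a - i - m for m > a - i. The terms dropped are 0.\<close>
    also have "(\<Sum>m\<in>{0..j}. zbinom j m * ?F m) =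
       (\<Sum>m\<in>{max 0 (j - int b)..min j (int a - i)}. zbinom j m * ?F m)"
      by (rule sum.mono_neutral_right) (auto simp: zbinom_def)
    finally show "(\<Sum>A'\<in>Pow J. ?F (int (card A'))) =
       (\<Sum>m\<in>{max 0 (j - int b)..min j (int a - i)}. zbinom j m * ?F m)" .
  qed
  also have "\<dots> = zbinom (int (card C)) i * (zbinom (int (card A)) j *
       (\<Sum>m\<in>{max 0 (j - int b)..min j (int a - i)}. zbinom j m * ?F m))"
    using card_subsets_int[OF fin(1)] card_subsets_int[OF fin(3)] by simp
  finally show ?thesis using bij_betw_same_card[OF bij] by (simp add: mult.assoc)
qed

text \<open>The quotient of N! by the trinomial coefficient is a! b! (N - a - b)!, the number of
  ways to order S, T and the remaining elements.\<close>

lemma DD_eq_card_split_pairs: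
  assumes "finite A" "finite B" "finite C" "A \<inter> B = {}" "A \<inter> C = {}" "B \<inter> C = {}"
    and "card A = r" "card B = s" "card C = t"
  shows "DD r s t a b i j =
    fact a * fact b * fact (r + s + t - a - b) * real (card (split_pairs A B C a b i j))"
  using assms(7-9) unfolding DD_def Let_def trinom_def card_split_pairs[OF assms(1-6)]
  by (simp add: mult.assoc)

text \<open>
  A list stands for the order of the observations: the entry at position \<open>k - 1\<close> is the index of
  the \<open>k\<close>-th smallest one.  The conditions say that this entry has rank \<open>i\<close> within \<open>A \<union> B\<close>, and
  the entry at position \<open>l - 1\<close> has rank \<open>j\<close> within \<open>B \<union> C\<close>.
\<close>

definition rank_lists ::
  "'b set \<Rightarrow> 'b set \<Rightarrow> 'b set \<Rightarrow> nat \<Rightarrow> nat \<Rightarrow> nat \<Rightarrow> nat \<Rightarrow> 'b list set" where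
  "rank_lists A B C i k j l = {xs \<in> permutations_of_set (A \<union> B \<union> C).
     xs ! (k - 1) \<in> A \<union> B \<and> card (set (take (k - 1) xs) \<inter> (A \<union> B)) = i - 1 \<and>
     xs ! (l - 1) \<in> B \<union> C \<and> card (set (take (l - 1) xs) \<inter> (B \<union> C)) = j - 1}"

text \<open>Concatenating an order of S and an order of P - S produces each such list once. The
  condition on the rest is an arbitrary predicate, so the lemma can be iterated to fix consecutive
  pieces of a list.\<close>

lemma card_permutations_of_set_take:
  assumes "finite P" "S \<subseteq> P"
  shows "card {xs \<in> permutations_of_set P. set (take (card S) xs) = S \<and> \<Phi> (drop (card S) xs)} =
    fact (card S) * card {ys \<in> permutations_of_set (P - S). \<Phi> ys}"
proof -
  have fS: "finite S" using assms finite_subset by blast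
  have "{xs \<in> permutations_of_set P. set (take (card S) xs) = S \<and> \<Phi> (drop (card S) xs)} =
    (\<lambda>(xs, ys). xs @ ys) ` (permutations_of_set S \<times> {ys \<in> permutations_of_set (P - S). \<Phi> ys})"
    (is "?L = ?R")
  proof (intro equalityI subsetI)
    fix xs assume "xs \<in> ?L"
    then have *: "set xs = P" "distinct xs" "set (take (card S) xs) = S" "\<Phi> (drop (card S) xs)"
      by (auto dest: permutations_of_setD)
    have "set (take (card S) xs) \<inter> set (drop (card S) xs) = {}"
      using * by (intro set_take_disj_set_drop_if_distinct) auto
    moreover have "set (take (card S) xs) \<union> set (drop (card S) xs) = P"
      using * by (metis append_take_drop_id set_append)
    ultimately have "set (drop (card S) xs) = P - S" using * by auto
    then show "xs \<in> ?R" using *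
      by (intro image_eqI[of _ _ "(take (card S) xs, drop (card S) xs)"]) auto
  next
    fix xs assume "xs \<in> ?R"
    then obtain ys zs where yz: "xs = ys @ zs" "ys \<in> permutations_of_set S"
      "zs \<in> permutations_of_set (P - S)" "\<Phi> zs" by auto
    then have *: "xs = ys @ zs" "set ys = S" "distinct ys" "set zs = P - S" "distinct zs" "\<Phi> zs"
      by (auto dest: permutations_of_setD)
    have "length ys = card S" using * distinct_card by metis
    then show "xs \<in> ?L" using * assms by (auto intro!: permutations_of_setI)
  qed
  moreover have "inj_on (\<lambda>(xs, ys). xs @ ys)
      (permutations_of_set S \<times> {ys \<in> permutations_of_set (P - S). \<Phi> ys})"
    by (auto simp: inj_on_def dest!: length_finite_permutations_of_set)
  ultimately show ?thesis
    by (simp add: card_image card_cartesian_product fS)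
qed

text \<open>Exchanging the outer blocks A and C, and with them the two ranks and positions, only
  interchanges the two conditions. This reduces k > l to k < l.\<close>

lemma rank_lists_swap: "rank_lists A B C i k j l = rank_lists C B A j l i k"
  unfolding rank_lists_def by (auto simp: Un_commute Un_left_commute Un_assoc)

lemma set_take_1_drop: "a < length xs \<Longrightarrow> set (take 1 (drop a xs)) = {xs ! a}"
  by (simp add: Cons_nth_drop_Suc[symmetric])

text \<open>
  A list is cut into the first \<open>k - 1\<close> entries, the entry \<open>u\<close>, the next \<open>l - k - 1\<close> entries, the
  entry \<open>v\<close>, and the rest.  Given the first three pieces, \<open>v\<close> is any of the \<open>card (B \<union> C) - j + 1\<close>
  unused elements of \<open>B \<union> C\<close>, whereas \<open>DD\<close> lets \<open>v\<close> and the rest be permuted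
  freely; this explains the quotient.
\<close>

lemma card_rank_lists_less:
  assumes fin: "finite A" "finite B" "finite C"
    and disj: "A \<inter> B = {}" "A \<inter> C = {}" "B \<inter> C = {}"
    and c: "card A = r" "card B = s" "card C = t"
    and ij: "1 \<le> i" "1 \<le> j" "j \<le> s + t" and kl: "1 \<le> k" "k < l" "l \<le> r + s + t"
  shows "real (card (rank_lists A B C i k j l)) =
    (real (s + t) - real j + 1) *
      (real r * DD (r - 1) s t (k - 1) (l - k - 1) (int k - int i) (int l - int j - 1) +
       real s * DD r (s - 1) t (k - 1) (l - k - 1) (int k - int i) (int l - int j)) /
      (real (r + s + t) - real l + 1)"
proof -
  let ?P = "A \<union> B \<union> C"
  define a where "a = k - 1"
  define b where "b = l - k - 1"
  \<comment> \<open>The pieces before u and between u and v have sizes a and b, so u and v sit at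
    the 0-based positions a = k - 1 and a + b + 1 = l - 1.\<close>
  have ab: "k = Suc a" "l = Suc (Suc (a + b))" using kl by (auto simp: a_def b_def)
  have cP: "card ?P = r + s + t" using card_Un3_disjoint[OF fin disj] c by simp
  have fP: "finite ?P" using fin by simp
  \<comment> \<open>The rank conditions on what precedes v. Since u is not among its own
    predecessors, it matters only for the second rank, where it may be one of the j - 1 predecessors
    of v in B \<union> C.\<close>
  define D where "D u = {(S, T). S \<subseteq> ?P - {u} \<and> T \<subseteq> ?P - {u} \<and> S \<inter> T = {} \<and> card S = a \<and> card T = b \<and>
      card (S \<inter> (A \<union> B)) = i - 1 \<and> card ((S \<union> {u} \<union> T) \<inter> (B \<union> C)) = j - 1}" for u
  \<comment> \<open>What is left of a list when the order inside the pieces S and T and everything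
    after v are forgotten.\<close>
  define W where "W = (SIGMA u:A \<union> B. SIGMA ST:D u. (B \<union> C) - (fst ST \<union> {u} \<union> snd ST))"
  define F where "F xs = (xs ! a, (set (take a xs), set (take b (drop (Suc a) xs))), xs ! (Suc (a + b)))"
    for xs :: "'a list"
  have finD: "finite (D u)" for u
    by (rule finite_subset[of _ "Pow ?P \<times> Pow ?P"]) (use fP in \<open>auto simp: D_def\<close>)
  have finW: "finite W" unfolding W_def using fin finD by (intro finite_SigmaI) auto
  have decomp: "set (take (Suc (a + b)) xs) = set (take a xs) \<union> {xs ! a} \<union> set (take b (drop (Suc a) xs))"
    if "length xs = r + s + t" for xs :: "'a list"
  proof -
    have "take (Suc (a + b)) xs = take a xs @ take (Suc b) (drop a xs)"
      using take_add[of a "Suc b" xs] by simp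
    also have "take (Suc b) (drop a xs) = xs ! a # take b (drop (Suc a) xs)"
      using that kl ab by (subst Cons_nth_drop_Suc[symmetric]) auto
    finally show ?thesis by auto
  qed
  have disjoint_parts: "xs ! a \<notin> set (take a xs)" "xs ! a \<notin> set (take b (drop (Suc a) xs))"
     "set (take a xs) \<inter> set (take b (drop (Suc a) xs)) = {}"
     "xs ! (Suc (a + b)) \<notin> set (take a xs) \<union> {xs ! a} \<union> set (take b (drop (Suc a) xs))"
    if "length xs = r + s + t" "distinct xs" for xs :: "'a list"
  proof -
    have "xs = take a xs @ [xs ! a] @ take b (drop (Suc a) xs) @ drop (Suc (a + b)) xs"
      using that kl ab id_take_nth_drop[of a xs] append_take_drop_id[of b "drop (Suc a) xs"]
      by (simp add: add.commute)
    moreover have "drop (Suc (a + b)) xs = xs ! (Suc (a + b)) # drop (Suc (Suc (a + b))) xs"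
      using that kl ab by (simp add: Cons_nth_drop_Suc)
    ultimately have "distinct (take a xs @ [xs ! a] @ take b (drop (Suc a) xs) @
        xs ! (Suc (a + b)) # drop (Suc (Suc (a + b))) xs)" using that by metis
    then show "xs ! a \<notin> set (take a xs)" "xs ! a \<notin> set (take b (drop (Suc a) xs))"
     "set (take a xs) \<inter> set (take b (drop (Suc a) xs)) = {}"
     "xs ! (Suc (a + b)) \<notin> set (take a xs) \<union> {xs ! a} \<union> set (take b (drop (Suc a) xs))"
      by auto
  qed
  have len: "length xs = r + s + t" "distinct xs" "set xs = ?P" if "xs \<in> permutations_of_set ?P" for xs
    using that cP length_finite_permutations_of_set[OF that] permutations_of_setD[OF that] by auto
  have mem: "xs \<in> rank_lists A B C i k j l \<longleftrightarrow> F xs \<in> W" if xs: "xs \<in> permutations_of_set ?P" for xs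
  proof -
    note l = len[OF xs] and d = disjoint_parts[OF len(1,2)[OF xs]]
    have sub: "set (take a xs) \<subseteq> ?P" "set (take b (drop (Suc a) xs)) \<subseteq> ?P"
      using l(3) set_take_subset[of a xs] set_take_subset[of b "drop (Suc a) xs"] set_drop_subset[of "Suc a" xs]
      by auto
    have "card (set (take a xs)) = a" "card (set (take b (drop (Suc a) xs))) = b"
      using l kl ab by (simp_all add: distinct_card)
    then show ?thesis
      unfolding rank_lists_def W_def D_def F_def using xs l d sub ab decomp[OF l(1)] by auto
  qed
  have mem2: "rank_lists A B C i k j l = {xs \<in> permutations_of_set ?P. F xs \<in> W}"
  proof (intro set_eqI iffI CollectI conjI)
    fix xs assume xs: "xs \<in> rank_lists A B C i k j l"
    then show 1: "xs \<in> permutations_of_set ?P" by (simp add: rank_lists_def)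
    show "F xs \<in> W" using mem[OF 1] xs by (rule iffD1)
  next
    fix xs assume "xs \<in> {xs \<in> permutations_of_set ?P. F xs \<in> W}"
    then show "xs \<in> rank_lists A B C i k j l" using mem by simp
  qed
  \<comment> \<open>The forgotten orders of S, of T and of the r + s + t - l entries after v can be
    chosen freely, so all fibres of \<open>F\<close> have the same size.\<close>
  have card_lists: "card (rank_lists A B C i k j l) = (fact a * fact b * fact (r + s + t - l)) * card W"
  proof (rule card_eq_mult_fibre[where f = F])
    show "finite (rank_lists A B C i k j l)" unfolding rank_lists_def by simp
    show "finite W" by fact
    show "F xs \<in> W" if "xs \<in> rank_lists A B C i k j l" for xs
      using that unfolding mem2 by simp
  next
    fix w assume w: "w \<in> W"
    then obtain u S T v where weq: "w = (u, (S, T), v)" and u: "u \<in> A \<union> B" and ST: "(S, T) \<in> D u"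
      and "v \<in> (B \<union> C) - (S \<union> {u} \<union> T)" unfolding W_def by fastforce
    then have v: "v \<in> B \<union> C" "v \<notin> S" "v \<noteq> u" "v \<notin> T" by auto
    have ST': "S \<subseteq> ?P - {u}" "T \<subseteq> ?P - {u}" "S \<inter> T = {}" "card S = a" "card T = b"
      using ST by (auto simp: D_def)
    have fST: "finite S" "finite T" using ST' fP by (meson finite_Diff finite_subset)+
    have "{xs \<in> rank_lists A B C i k j l. F xs = w} = {xs \<in> permutations_of_set ?P. F xs = w}"
      unfolding mem2 using w by auto
    \<comment> \<open>The nested predicates cut off S, u, T and v in turn; in this form
      \<open>card_permutations_of_set_take\<close> applies four times.\<close>
    also have "\<dots> = {xs \<in> permutations_of_set ?P. set (take (card S) xs) = S \<and>
      (\<lambda>ys. set (take (card {u}) ys) = {u} \<and>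
        (\<lambda>ys. set (take (card T) ys) = T \<and>
           (\<lambda>ys. set (take (card {v}) ys) = {v} \<and> (\<lambda>_. True) (drop (card {v}) ys))
         (drop (card T) ys)) (drop (card {u}) ys)) (drop (card S) xs)}"
      (is "_ = {xs \<in> _. ?Q xs}")
    proof (rule Collect_cong, rule conj_cong[OF refl])
      fix xs assume xs: "xs \<in> permutations_of_set ?P"
      have "set (take 1 (drop a xs)) = {xs ! a}" "set (take 1 (drop (Suc (a + b)) xs)) = {xs ! (Suc (a + b))}"
        using len[OF xs] kl ab by (simp_all only: set_take_1_drop)
      then show "F xs = w \<longleftrightarrow> ?Q xs"
        unfolding F_def weq using ST' by (auto simp: add.commute)
    qed
    also have "card \<dots> = fact a * (fact b * fact (r + s + t - l))"
    proof -
      have "card (?P - S - {u} - T - {v}) = card (?P - (S \<union> {u} \<union> T \<union> {v}))"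
        by (rule arg_cong[where f = card]) auto
      also have "\<dots> = card ?P - card (S \<union> {u} \<union> T \<union> {v})"
        using u v ST' fST by (intro card_Diff_subset) auto
      also have "card (S \<union> {u} \<union> T \<union> {v}) = Suc (card (S \<union> {u} \<union> T))" using v fST by simp
      also have "card (S \<union> {u} \<union> T) = card S + card {u} + card T"
        using ST' fST by (intro card_Un3_disjoint) auto
      finally have "card (?P - S - {u} - T - {v}) = r + s + t - l" using cP ST' ab by simp
      then show ?thesis
        apply (subst card_permutations_of_set_take)
        subgoal by (rule fP)
        subgoal using ST' by blast
        apply (subst card_permutations_of_set_take)
        subgoal using fP by blast
        subgoal using ST' u by blast
        apply (subst card_permutations_of_set_take)
        subgoal using fP by blast
        subgoal using ST' u by blast
        apply (subst card_permutations_of_set_take)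
        subgoal using fP by blast
        subgoal using ST' u v by blast
        using fP ST' by simp
    qed
    finally show "card {xs \<in> rank_lists A B C i k j l. F xs = w} = fact a * fact b * fact (r + s + t - l)"
      by simp
  qed
  \<comment> \<open>Exactly j - 1 elements of B \<union> C are used up before v, whatever u, S and T
    are, so the number of choices for v is constant.\<close>
  have cardW: "card W = (s + t - (j - 1)) * (\<Sum>u\<in>A \<union> B. card (D u))"
  proof -
    have cv: "card ((B \<union> C) - (fst ST \<union> {u} \<union> snd ST)) = s + t - (j - 1)" if "ST \<in> D u" for u ST
    proof -
      have "(B \<union> C) - (fst ST \<union> {u} \<union> snd ST) = (B \<union> C) - (fst ST \<union> {u} \<union> snd ST) \<inter> (B \<union> C)" by auto
      also have "card \<dots> = card (B \<union> C) - card ((fst ST \<union> {u} \<union> snd ST) \<inter> (B \<union> C))"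
        using fin by (intro card_Diff_subset) auto
      finally show ?thesis using that c fin disj by (auto simp: D_def card_Un_disjoint)
    qed
    have "card W = (\<Sum>u\<in>A \<union> B. \<Sum>ST\<in>D u. card ((B \<union> C) - (fst ST \<union> {u} \<union> snd ST)))"
      unfolding W_def using fin finD by (simp add: card_SigmaI)
    also have "\<dots> = (\<Sum>u\<in>A \<union> B. \<Sum>ST\<in>D u. s + t - (j - 1))"
      by (intro sum.cong refl cv)
    finally show ?thesis by (simp add: sum_distrib_left mult.commute)
  qed
  have sumAB: "(\<Sum>u\<in>A \<union> B. card (D u)) = (\<Sum>u\<in>A. card (D u)) + (\<Sum>u\<in>B. card (D u))"
    using fin disj by (simp add: sum.union_disjoint)
  let ?q = "int k - int i"
  have cardsplit: "card (S \<inter> (A \<union> B)) + card (S \<inter> C) = card S"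
    "card (S \<inter> (B \<union> C)) + card (S \<inter> A) = card S" if "S \<subseteq> ?P" for S
  proof -
    have "finite S" using that fP finite_subset by blast
    then show "card (S \<inter> (A \<union> B)) + card (S \<inter> C) = card S"
      "card (S \<inter> (B \<union> C)) + card (S \<inter> A) = card S"
      using that disj by (intro card_Int_add_Int; blast)+
  qed
  \<comment> \<open>S \<union> T has a + b = l - 2 elements, of which j - 1 lie in B \<union> C,
    because u in A does not count there. This leaves l - j - 1 in A.\<close>
  have DA: "D u = split_pairs (A - {u}) B C a b ?q (int l - int j - 1)" if u: "u \<in> A" for u
  proof -
    have "(S, T) \<in> D u \<longleftrightarrow> (S, T) \<in> split_pairs (A - {u}) B C a b ?q (int l - int j - 1)" for S T
    proof (cases "S \<subseteq> ?P - {u} \<and> T \<subseteq> ?P - {u} \<and> S \<inter> T = {} \<and> card S = a \<and> card T = b")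
      case True
      have fST: "finite S" "finite T" using True fP by (meson finite_Diff finite_subset)+
      have 1: "card (S \<inter> (A \<union> B)) + card (S \<inter> C) = a" using cardsplit True by blast
      have 2: "card ((S \<union> T) \<inter> (B \<union> C)) + card ((S \<union> T) \<inter> A) = a + b"
        using cardsplit(2)[of "S \<union> T"] True fST by (simp add: card_Un_disjoint subset_Diff_insert)
      have 3: "(S \<union> {u} \<union> T) \<inter> (B \<union> C) = (S \<union> T) \<inter> (B \<union> C)" "(S \<union> T) \<inter> (A - {u}) = (S \<union> T) \<inter> A"
        using u True disj by auto
      have 4: "A - {u} \<union> B \<union> C = ?P - {u}" using u disj by auto
      show ?thesis unfolding D_def split_pairs_def mem_Collect_eq case_prod_conv 3 4
        using True 1 2 ij ab by linarith
    next
      case False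
      have 4: "A - {u} \<union> B \<union> C = ?P - {u}" using u disj by auto
      show ?thesis unfolding D_def split_pairs_def mem_Collect_eq case_prod_conv 4
        using False by blast
    qed
    then show ?thesis by auto
  qed
  \<comment> \<open>Now u is itself one of the j - 1 predecessors in B \<union> C, so S \<union> T
    supplies only j - 2 of them, and its other l - j elements lie in A.\<close>
  have DB: "D u = split_pairs A (B - {u}) C a b ?q (int l - int j)" if u: "u \<in> B" for u
  proof -
    have "(S, T) \<in> D u \<longleftrightarrow> (S, T) \<in> split_pairs A (B - {u}) C a b ?q (int l - int j)" for S T
    proof (cases "S \<subseteq> ?P - {u} \<and> T \<subseteq> ?P - {u} \<and> S \<inter> T = {} \<and> card S = a \<and> card T = b")
      case True
      have fST: "finite S" "finite T" using True fP by (meson finite_Diff finite_subset)+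
      have 1: "card (S \<inter> (A \<union> B)) + card (S \<inter> C) = a" using cardsplit True by blast
      have 2: "card ((S \<union> T) \<inter> (B \<union> C)) + card ((S \<union> T) \<inter> A) = a + b"
        using cardsplit(2)[of "S \<union> T"] True fST by (simp add: card_Un_disjoint subset_Diff_insert)
      have "(S \<union> {u} \<union> T) \<inter> (B \<union> C) = insert u ((S \<union> T) \<inter> (B \<union> C))"
        using u by auto
      then have 3: "card ((S \<union> {u} \<union> T) \<inter> (B \<union> C)) = Suc (card ((S \<union> T) \<inter> (B \<union> C)))"
        using u True fST by (simp add: subset_Diff_insert)
      have 4: "A \<union> (B - {u}) \<union> C = ?P - {u}" using u disj by auto
      show ?thesis unfolding D_def split_pairs_def mem_Collect_eq case_prod_conv 3 4
        using True 1 2 ij ab by linarith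
    next
      case False
      have 4: "A \<union> (B - {u}) \<union> C = ?P - {u}" using u disj by auto
      show ?thesis unfolding D_def split_pairs_def mem_Collect_eq case_prod_conv 4
        using False by blast
    qed
    then show ?thesis by auto
  qed
  \<comment> \<open>With N = r + s + t, \<open>DD\<close> on the N - 1 elements other than u orders
    N - 1 - a - b = N - l + 1 remaining entries, v included. The fibres of \<open>F\<close>
    contribute only (N - l)!; the ratio N - l + 1 becomes the denominator.\<close>
  let ?f = "fact a * fact b * fact (r + s + t - l + 1) :: real"
  have fA: "?f * real (\<Sum>u\<in>A. card (D u)) = real r * DD (r - 1) s t a b ?q (int l - int j - 1)"
  proof -
    have "?f * real (card (D u)) = DD (r - 1) s t a b ?q (int l - int j - 1)" if u: "u \<in> A" for u
    proof -
      have "r > 0" using u c fin by (auto simp: card_gt_0_iff)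
      then have "r - 1 + s + t - a - b = r + s + t - l + 1" using kl ab by auto
      moreover have "(A - {u}) \<inter> B = {}" "(A - {u}) \<inter> C = {}" using disj by auto
      ultimately show ?thesis
        using DD_eq_card_split_pairs[of "A - {u}" B C "r - 1" s t a b ?q "int l - int j - 1"]
          u fin disj c DA[OF u] by (simp del: fact_Suc)
    qed
    then show ?thesis using c by (simp add: sum_distrib_left)
  qed
  have fB: "?f * real (\<Sum>u\<in>B. card (D u)) = real s * DD r (s - 1) t a b ?q (int l - int j)"
  proof -
    have "?f * real (card (D u)) = DD r (s - 1) t a b ?q (int l - int j)" if u: "u \<in> B" for u
    proof -
      have "s > 0" using u c fin by (auto simp: card_gt_0_iff)
      then have "r + (s - 1) + t - a - b = r + s + t - l + 1" using kl ab by auto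
      moreover have "A \<inter> (B - {u}) = {}" "(B - {u}) \<inter> C = {}" using disj by auto
      ultimately show ?thesis
        using DD_eq_card_split_pairs[of A "B - {u}" C r "s - 1" t a b ?q "int l - int j"]
          u fin disj c DB[OF u] by (simp del: fact_Suc)
    qed
    then show ?thesis using c by (simp add: sum_distrib_left)
  qed
  let ?x = "real (\<Sum>u\<in>A. card (D u))" and ?y = "real (\<Sum>u\<in>B. card (D u))"
  let ?z = "real (r + s + t) - real l + 1" and ?g = "fact a * fact b * fact (r + s + t - l) :: real"
  let ?w = "real (s + t) - real j + 1"
  have fz: "?f = ?g * ?z" using kl by (simp add: of_nat_diff algebra_simps)
  have w: "real (s + t - (j - 1)) = ?w" using ij by simp
  have z: "?z > 0" using kl by linarith
  have alg: "c * z = w * ((g * z) * x + (g * z) * y)" if "c = g * (w * (x + y))" for c g w x y z :: real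
    using that by (simp add: algebra_simps)
  have "real (card (rank_lists A B C i k j l)) = ?g * (?w * (?x + ?y))"
    unfolding card_lists cardW sumAB of_nat_mult w by simp
  then have "real (card (rank_lists A B C i k j l)) * ?z = ?w * (?f * ?x + ?f * ?y)"
    unfolding fz by (rule alg)
  then show ?thesis
    unfolding fA fB a_def[symmetric] b_def[symmetric] using z by (simp only: eq_divide_eq) simp
qed

lemma card_rank_lists_greater:
  assumes fin: "finite A" "finite B" "finite C"
    and disj: "A \<inter> B = {}" "A \<inter> C = {}" "B \<inter> C = {}"
    and c: "card A = r" "card B = s" "card C = t"
    and ij: "1 \<le> i" "1 \<le> j" "i \<le> r + s" and kl: "1 \<le> l" "l < k" "k \<le> r + s + t"
  shows "real (card (rank_lists A B C i k j l)) =
    (real (r + s) - real i + 1) *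
      (real t * DD (t - 1) s r (l - 1) (k - l - 1) (int l - int j) (int k - int i - 1) +
       real s * DD t (s - 1) r (l - 1) (k - l - 1) (int l - int j) (int k - int i)) /
      (real (r + s + t) - real k + 1)"
proof -
  have e: "t + s + r = r + s + t" "s + r = r + s" by simp_all
  have d: "C \<inter> B = {}" "C \<inter> A = {}" "B \<inter> A = {}" using disj by auto
  show ?thesis
    unfolding rank_lists_swap[of A B C]
    using card_rank_lists_less[OF fin(3,2,1) d c(3,2,1) ij(2,1) _ kl(1,2)] ij kl
    unfolding e by blast
qed

text \<open>One entry u satisfies both conditions, so it lies in the intersection B of the two
  samples. There is no second distinguished entry: the middle piece is empty, and the N - k entries
  after u are permuted freely on both sides (N = r + s + t), so no quotient appears.\<close>

lemma card_rank_lists_equal: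
  assumes fin: "finite A" "finite B" "finite C"
    and disj: "A \<inter> B = {}" "A \<inter> C = {}" "B \<inter> C = {}"
    and c: "card A = r" "card B = s" "card C = t"
    and ij: "1 \<le> i" "1 \<le> j" and k: "1 \<le> k" "k \<le> r + s + t"
  shows "real (card (rank_lists A B C i k j k)) =
    real s * DD r (s - 1) t (k - 1) 0 (int k - int i) (int k - int j)"
proof -
  let ?P = "A \<union> B \<union> C" and ?q = "int k - int i" and ?p = "int k - int j"
  define a where "a = k - 1"
  have ka: "k = Suc a" using k by (simp add: a_def)
  have cP: "card ?P = r + s + t" using card_Un3_disjoint[OF fin disj] c by simp
  have fP: "finite ?P" using fin by simp
  let ?D = "\<lambda>u. split_pairs A (B - {u}) C a 0 ?q ?p"
  \<comment> \<open>The component \<open>{}\<close> plays the role of T for b = 0, so that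
    \<open>split_pairs\<close> can be reused.\<close>
  define F where "F xs = (xs ! a, (set (take a xs), {} :: 'a set))" for xs :: "'a list"
  have finD: "finite (?D u)" for u
    using fin by (intro finite_split_pairs) auto
  have Peq: "A \<union> (B - {u}) \<union> C = ?P - {u}" if "u \<in> B" for u using that disj by auto
  have mem: "xs \<in> rank_lists A B C i k j k \<longleftrightarrow> F xs \<in> Sigma B ?D"
    if xs: "xs \<in> permutations_of_set ?P" for xs
  proof -
    have l: "length xs = r + s + t" "distinct xs" "set xs = ?P"
      using cP length_finite_permutations_of_set[OF xs] permutations_of_setD[OF xs] by auto
    let ?S = "set (take a xs)"
    have cS: "card ?S = a" using l k ka by (simp add: distinct_card)
    have "xs = take a xs @ xs ! a # drop (Suc a) xs"
      using l k ka by (intro id_take_nth_drop) simp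
    then have n: "xs ! a \<notin> ?S" using l(2) by (metis disjoint_insert(1) distinct_append list.set(2))
    have sub: "?S \<subseteq> ?P" using l(3) set_take_subset[of a xs] by simp
    have "finite ?S" by simp
    then have c1: "card (?S \<inter> (A \<union> B)) + card (?S \<inter> C) = a" "card (?S \<inter> (B \<union> C)) + card (?S \<inter> A) = a"
      using card_Int_add_Int[of ?S "A \<union> B" C] card_Int_add_Int[of ?S "B \<union> C" A] sub disj cS by auto
    have "xs ! a \<in> A \<union> B \<and> xs ! a \<in> B \<union> C \<longleftrightarrow> xs ! a \<in> B" using disj by auto
    moreover have "card (?S \<inter> (A \<union> B)) = i - 1 \<longleftrightarrow> int (card (?S \<inter> C)) = ?q"
      "card (?S \<inter> (B \<union> C)) = j - 1 \<longleftrightarrow> int (card (?S \<inter> A)) = ?p"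
      using c1 ij ka by linarith+
    ultimately show ?thesis
      unfolding rank_lists_def F_def split_pairs_def using xs sub n cS ka Peq by auto
  qed
  have mem2: "rank_lists A B C i k j k = {xs \<in> permutations_of_set ?P. F xs \<in> Sigma B ?D}"
  proof (intro set_eqI iffI CollectI conjI)
    fix xs assume xs: "xs \<in> rank_lists A B C i k j k"
    then show 1: "xs \<in> permutations_of_set ?P" by (simp add: rank_lists_def)
    show "F xs \<in> Sigma B ?D" using mem[OF 1] xs by (rule iffD1)
  next
    fix xs assume "xs \<in> {xs \<in> permutations_of_set ?P. F xs \<in> Sigma B ?D}"
    then show "xs \<in> rank_lists A B C i k j k" using mem by simp
  qed
  have "card (rank_lists A B C i k j k) = (fact a * fact (r + s + t - k)) * card (Sigma B ?D)"
  proof (rule card_eq_mult_fibre[where f = F])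
    show "finite (rank_lists A B C i k j k)" unfolding rank_lists_def by simp
    show "finite (Sigma B ?D)" using fin finD by (intro finite_SigmaI) auto
    show "F xs \<in> Sigma B ?D" if "xs \<in> rank_lists A B C i k j k" for xs
      using that unfolding mem2 by simp
  next
    fix w assume w: "w \<in> Sigma B ?D"
    then obtain u S T where weq: "w = (u, (S, T))" and u: "u \<in> B" and ST: "(S, T) \<in> ?D u"
      by auto
    have fS: "finite S" "finite T"
      using ST fin by (auto simp: split_pairs_def elim!: finite_subset)
    then have ST': "S \<subseteq> ?P - {u}" "T = {}" "card S = a"
      using ST unfolding split_pairs_def Peq[OF u] by auto
    have "{xs \<in> rank_lists A B C i k j k. F xs = w} = {xs \<in> permutations_of_set ?P. F xs = w}"
      unfolding mem2 using w by auto
    also have "\<dots> = {xs \<in> permutations_of_set ?P. set (take (card S) xs) = S \<and>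
      (\<lambda>ys. set (take (card {u}) ys) = {u} \<and> (\<lambda>_. True) (drop (card {u}) ys)) (drop (card S) xs)}"
      (is "_ = {xs \<in> _. ?Q xs}")
    proof (rule Collect_cong, rule conj_cong[OF refl])
      fix xs assume xs: "xs \<in> permutations_of_set ?P"
      have "set (take 1 (drop a xs)) = {xs ! a}"
        using cP length_finite_permutations_of_set[OF xs] k ka by (simp only: set_take_1_drop)
      then show "F xs = w \<longleftrightarrow> ?Q xs"
        unfolding F_def weq using ST' by auto
    qed
    also have "card \<dots> = fact a * fact (r + s + t - k)"
    proof -
      have "card (?P - S - {u}) = card (?P - insert u S)"
        by (rule arg_cong[where f = card]) auto
      also have "\<dots> = card ?P - card (insert u S)"
        using u ST' fS by (intro card_Diff_subset) auto
      also have "card (insert u S) = Suc (card S)" using ST' fS by (simp add: subset_Diff_insert)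
      finally have "card (?P - S - {u}) = r + s + t - k" using cP ST' ka by simp
      then show ?thesis
        apply (subst card_permutations_of_set_take)
        subgoal by (rule fP)
        subgoal using ST' by blast
        apply (subst card_permutations_of_set_take)
        subgoal using fP by blast
        subgoal using ST' u by blast
        using fP ST' by simp
    qed
    finally show "card {xs \<in> rank_lists A B C i k j k. F xs = w} = fact a * fact (r + s + t - k)" .
  qed
  then have "real (card (rank_lists A B C i k j k)) =
      (\<Sum>u\<in>B. fact a * fact (r + s + t - k) * real (card (?D u)))"
    using fin finD by (simp add: card_SigmaI sum_distrib_left)
  also have "\<dots> = (\<Sum>u\<in>B. DD r (s - 1) t a 0 ?q ?p)"
  proof (rule sum.cong[OF refl])
    fix u assume u: "u \<in> B"
    have "s > 0" using u c fin by (auto simp: card_gt_0_iff)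
    then have "r + (s - 1) + t - a - 0 = r + s + t - k" using k ka by auto
    moreover have "A \<inter> (B - {u}) = {}" "(B - {u}) \<inter> C = {}" using disj by auto
    ultimately show "fact a * fact (r + s + t - k) * real (card (?D u)) = DD r (s - 1) t a 0 ?q ?p"
      using DD_eq_card_split_pairs[of A "B - {u}" C r "s - 1" t a 0 ?q ?p] u fin disj c by simp
  qed
  finally show ?thesis using c by (simp add: a_def)
qed

text \<open>Position k has k - 1 predecessors, i - 1 in A \<union> B and the other k - i in C; hence
  k - i lies between 0 and the size of C. In the same way l - j counts elements of A.\<close>

lemma rank_lists_bounds:
  assumes fin: "finite A" "finite B" "finite C"
    and disj: "A \<inter> B = {}" "A \<inter> C = {}" "B \<inter> C = {}"
    and ij: "1 \<le> i" "1 \<le> j"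
    and kl: "1 \<le> k" "k \<le> card A + card B + card C" "1 \<le> l" "l \<le> card A + card B + card C"
    and xs: "xs \<in> rank_lists A B C i k j l"
  shows "i \<le> k \<and> k \<le> i + card C \<and> j \<le> l \<and> l \<le> j + card A"
proof -
  let ?P = "A \<union> B \<union> C" and ?S = "\<lambda>k. set (take (k - 1) xs)"
  have perm: "xs \<in> permutations_of_set ?P"
    and k: "card (?S k \<inter> (A \<union> B)) = i - 1" and l: "card (?S l \<inter> (B \<union> C)) = j - 1"
    using xs by (simp_all add: rank_lists_def)
  have len: "length xs = card A + card B + card C"
    using length_finite_permutations_of_set[OF perm] card_Un3_disjoint[OF fin disj] by simp
  have sub: "?S k \<subseteq> ?P" for k
    using set_take_subset[of "k - 1" xs] permutations_of_setD(1)[OF perm] by simp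
  have cS: "card (?S k) = k - 1" if "k \<le> card A + card B + card C" for k
    using that len permutations_of_setD(2)[OF perm] by (simp add: distinct_card)
  have "card (?S k \<inter> (A \<union> B)) + card (?S k \<inter> C) = card (?S k)"
    using disj sub by (intro card_Int_add_Int) auto
  moreover have "card (?S l \<inter> (B \<union> C)) + card (?S l \<inter> A) = card (?S l)"
    using disj sub[of l] by (intro card_Int_add_Int) auto
  moreover have "card (?S k \<inter> C) \<le> card C" "card (?S l \<inter> A) \<le> card A"
    using fin by (simp_all add: card_mono)
  ultimately show ?thesis using k l cS[OF kl(2)] cS[OF kl(4)] ij kl(1,3) by linarith
qed

section \<open>Order statistics of distinct values\<close>

text \<open>The entries that are at most a form an initial segment of a sorted list.\<close>

lemma sorted_nth_le_iff:
  fixes xs :: "'b::linorder list"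
  assumes "sorted xs" "k < length xs"
  shows "xs ! k \<le> a \<longleftrightarrow> k < length (filter (\<lambda>x. x \<le> a) xs)"
  using assms
proof (induction xs arbitrary: k)
  case (Cons x xs)
  show ?case
  proof (cases "x \<le> a")
    case True
    then show ?thesis using Cons by (cases k) auto
  next
    case False
    then have "filter (\<lambda>y. y \<le> a) (x # xs) = []" using Cons.prems by (fastforce simp: filter_empty_conv)
    moreover have "x \<le> (x # xs) ! k" using Cons.prems by (cases k) auto
    ultimately show ?thesis using False by auto
  qed
qed simp

lemma length_filter_eq_card: "distinct xs \<Longrightarrow> length (filter P xs) = card {x \<in> set xs. P x}"
  by (metis distinct_card distinct_filter set_filter)

text \<open>Replaces sorting by counting, so that measurability of an order statistic reduces to
  that of a finite sum of indicators.\<close>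

lemma order_stat_le_iff:
  assumes "1 \<le> k" "k \<le> N"
  shows "order_stat X k N \<omega> \<le> a \<longleftrightarrow> k \<le> (\<Sum>p=1..N. if X p \<omega> \<le> a then 1 else 0)"
proof -
  let ?xs = "map (\<lambda>p. X p \<omega>) [1..<N + 1]"
  have "order_stat X k N \<omega> \<le> a \<longleftrightarrow> k - 1 < length (filter (\<lambda>x. x \<le> a) (sort ?xs))"
    unfolding order_stat_def using assms by (intro sorted_nth_le_iff) auto
  also have "length (filter (\<lambda>x. x \<le> a) (sort ?xs)) = length (filter (\<lambda>x. x \<le> a) ?xs)"
    by (simp add: filter_sort)
  also have "\<dots> = card {p \<in> {1..N}. X p \<omega> \<le> a}"
    by (simp del: upt_Suc add: filter_map length_filter_eq_card atLeastLessThanSuc_atLeastAtMost)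
  also have "\<dots> = (\<Sum>p=1..N. if X p \<omega> \<le> a then 1 else 0)"
    by (simp add: sum.If_cases Int_def)
  finally show ?thesis using assms by linarith
qed

lemma measurable_order_stat:
  assumes X: "\<And>p. 1 \<le> p \<Longrightarrow> p \<le> N \<Longrightarrow> X p \<in> borel_measurable M" and k: "1 \<le> k" "k \<le> N"
  shows "order_stat X k N \<in> borel_measurable M"
proof (rule borel_measurableI_le)
  fix a
  have [measurable]: "(\<lambda>\<omega>. \<Sum>p=1..N. if X p \<omega> \<le> a then 1 else 0 :: nat) \<in> measurable M (count_space UNIV)"
  proof (rule measurable_sum_nat)
    fix p assume "p \<in> {1..N}"
    then have [measurable]: "X p \<in> borel_measurable M" using X by auto
    show "(\<lambda>\<omega>. if X p \<omega> \<le> a then 1 else 0 :: nat) \<in> measurable M (count_space UNIV)"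
      by measurable
  qed
  show "{\<omega> \<in> space M. order_stat X k N \<omega> \<le> a} \<in> sets M"
    unfolding order_stat_le_iff[OF k] by measurable
qed

lemma order_stat_in_sample:
  assumes "1 \<le> k" "k \<le> N"
  shows "\<exists>p\<in>{1..N}. order_stat X k N \<omega> = X p \<omega>"
proof -
  let ?xs = "map (\<lambda>p. X p \<omega>) [1..<N + 1]"
  have "sort ?xs ! (k - 1) \<in> set (sort ?xs)" using assms by (intro nth_mem) auto
  then show ?thesis unfolding order_stat_def by force
qed

text \<open>An entry satisfying P moves to the position given by the number of earlier entries
  satisfying P, and distinctness excludes any other position. Applied to a list that orders the full
  sample, this reads off ranks within a subsample.\<close>

lemma filter_nth_eq_iff:
  assumes "distinct xs" "a < length xs" "b < length (filter P xs)"
  shows "filter P xs ! b = xs ! a \<longleftrightarrow> P (xs ! a) \<and> length (filter P (take a xs)) = b"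
proof -
  have xs: "xs = take a xs @ xs ! a # drop (Suc a) xs" using assms by (intro id_take_nth_drop)
  have nth: "filter P xs ! length (filter P (take a xs)) = xs ! a"
    and len: "length (filter P (take a xs)) < length (filter P xs)" if "P (xs ! a)"
    using that by (subst xs, subst filter_append, simp add: nth_append)+
  show ?thesis
  proof
    assume eq: "filter P xs ! b = xs ! a"
    then have P: "P (xs ! a)" using nth_mem[OF assms(3)] by simp
    moreover have "distinct (filter P xs)" using assms by simp
    ultimately show "P (xs ! a) \<and> length (filter P (take a xs)) = b"
      using nth_eq_iff_index_eq[of "filter P xs" b "length (filter P (take a xs))"] nth len assms eq by simp
  next
    assume "P (xs ! a) \<and> length (filter P (take a xs)) = b"
    then show "filter P xs ! b = xs ! a" using nth by blast
  qed
qed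

text \<open>A sublist of an increasing arrangement is increasing, so a subsample is sorted by
  restricting the order of the full sample to its indices.\<close>

lemma sort_map_eq_map_filter:
  fixes g :: "'b \<Rightarrow> 'c::linorder"
  assumes "sorted_wrt (<) (map g ys)" "set zs \<subseteq> set ys" "distinct zs"
  shows "sort (map g zs) = map g (filter (\<lambda>p. p \<in> set zs) ys)"
proof (rule properties_for_sort)
  have d: "distinct ys" "sorted (map g ys)"
    using assms(1) strict_sorted_iff[of "map g ys"] by (auto simp: distinct_map)
  have "set (filter (\<lambda>p. p \<in> set zs) ys) = set zs" using assms(2) by auto
  then have "mset (filter (\<lambda>p. p \<in> set zs) ys) = mset zs"
    using d assms(3) by (metis distinct_filter set_eq_iff_mset_eq_distinct)
  then show "mset (map g (filter (\<lambda>p. p \<in> set zs) ys)) = mset (map g zs)"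
    by (simp only: mset_map)
  show "sorted (map g (filter (\<lambda>p. p \<in> set zs) ys))"
    using d(2) by (simp add: sorted_map sorted_wrt_filter)
qed

text \<open>The order statistic of the subsample belongs to the i-th entry of ys among the indices
  of that subsample. Values are distinct, so equality of values is equality of indices and a
  condition on ys alone remains. The case r = 0 covers the unshifted sample.\<close>

lemma order_stat_shift_eq_iff:
  assumes ys: "sorted_wrt (<) (map (\<lambda>p. X p \<omega>) ys)" "ys \<in> permutations_of_set {1..N}"
    and rn: "r + n \<le> N" and i: "1 \<le> i" "i \<le> n" and k: "1 \<le> k" "k \<le> N"
  shows "order_stat (\<lambda>p. X (r + p)) i n \<omega> = X (ys ! (k - 1)) \<omega> \<longleftrightarrow>
    ys ! (k - 1) \<in> {r + 1..r + n} \<and> card (set (take (k - 1) ys) \<inter> {r + 1..r + n}) = i - 1"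
proof -
  let ?g = "\<lambda>p. X p \<omega>" and ?Q = "\<lambda>p. p \<in> {r + 1..r + n}"
  have y: "set ys = {1..N}" "distinct ys" "length ys = N"
    using ys(2) length_finite_permutations_of_set[OF ys(2)] by (auto dest: permutations_of_setD)
  have inj: "inj_on ?g (set ys)"
    using ys(1) strict_sorted_iff[of "map ?g ys"] by (auto simp: distinct_map)
  have shift: "map (\<lambda>p. X (r + p) \<omega>) [1..<n + 1] = map ?g [r + 1..<r + n + 1]"
    by (rule nth_equalityI) (simp_all del: upt_Suc)
  have set_shift: "p \<in> set [r + 1..<r + n + 1] \<longleftrightarrow> ?Q p" for p by auto
  have lenf: "length (filter ?Q ys) = n"
  proof -
    have "{p \<in> set ys. ?Q p} = {r + 1..r + n}" using y rn by auto
    then show ?thesis using length_filter_eq_card[OF y(2), of ?Q] by simp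
  qed
  have "sort (map ?g [r + 1..<r + n + 1]) = map ?g (filter (\<lambda>p. p \<in> set [r + 1..<r + n + 1]) ys)"
    by (rule sort_map_eq_map_filter[OF ys(1)]) (unfold y(1), use rn in auto)
  then have "sort (map (\<lambda>p. X (r + p) \<omega>) [1..<n + 1]) = map ?g (filter ?Q ys)"
    unfolding shift set_shift .
  then have "order_stat (\<lambda>p. X (r + p)) i n \<omega> = X (filter ?Q ys ! (i - 1)) \<omega>"
    unfolding order_stat_def using lenf i by simp
  moreover have "filter ?Q ys ! (i - 1) \<in> set ys" "ys ! (k - 1) \<in> set ys"
    using nth_mem[of "i - 1" "filter ?Q ys"] nth_mem[of "k - 1" ys] lenf i k y(3) by auto
  ultimately have "order_stat (\<lambda>p. X (r + p)) i n \<omega> = X (ys ! (k - 1)) \<omega> \<longleftrightarrow>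
      filter ?Q ys ! (i - 1) = ys ! (k - 1)"
    using inj_on_eq_iff[OF inj] by metis
  also have "\<dots> \<longleftrightarrow> ?Q (ys ! (k - 1)) \<and> length (filter ?Q (take (k - 1) ys)) = i - 1"
    using y k i lenf by (intro filter_nth_eq_iff) auto
  also have "length (filter ?Q (take (k - 1) ys)) = card (set (take (k - 1) ys) \<inter> {r + 1..r + n})"
    using y(2) by (subst length_filter_eq_card) (auto intro: arg_cong[where f = card])
  finally show ?thesis .
qed

lemma order_stat_full:
  assumes ys: "sorted_wrt (<) (map (\<lambda>p. X p \<omega>) ys)" "ys \<in> permutations_of_set {1..N}"
    and k: "1 \<le> k" "k \<le> N"
  shows "order_stat X k N \<omega> = X (ys ! (k - 1)) \<omega>"
proof -
  have y: "set ys = {1..N}" "distinct ys" "length ys = N"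
    using ys(2) length_finite_permutations_of_set[OF ys(2)] by (auto dest: permutations_of_setD)
  have "set (take (k - 1) ys) \<inter> {1..N} = set (take (k - 1) ys)"
    using y(1) set_take_subset[of "k - 1" ys] by auto
  moreover have "ys ! (k - 1) \<in> {1..N}" using y k nth_mem[of "k - 1" ys] by auto
  ultimately show ?thesis
    using order_stat_shift_eq_iff[where X = X and \<omega> = \<omega> and r = 0 and n = N and i = k, OF ys _ k k] y k by (simp add: distinct_card)
qed

lemma sorted_permutation_unique:
  fixes g :: "'b \<Rightarrow> 'c::linorder"
  assumes "sorted_wrt (<) (map g xs)" "sorted_wrt (<) (map g ys)" "set xs = set ys"
  shows "xs = ys"
  using assms strict_sorted_iff[of "map g xs"] strict_sorted_iff[of "map g ys"]
  by (intro map_sorted_distinct_set_unique[of g]) (auto simp: distinct_map)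

lemma sorted_permutation_exists:
  fixes g :: "nat \<Rightarrow> real"
  assumes "inj_on g {1..N}"
  shows "\<exists>ys\<in>permutations_of_set {1..N}. sorted_wrt (<) (map g ys)"
proof
  let ?ys = "sort_key g [1..<N + 1]"
  have s: "set ?ys = {1..N}" "distinct ?ys" by auto
  then show "?ys \<in> permutations_of_set {1..N}" by (intro permutations_of_setI)
  have "inj_on g (set ?ys)" using assms s(1) by simp
  then show "sorted_wrt (<) (map g ?ys)"
    using s(2) sorted_sort_key[of g "[1..<N + 1]"] by (simp only: strict_sorted_iff distinct_map simp_thms)
qed

section \<open>Independent samples from a density\<close>

locale iid_density = prob_space M for M :: "'a measure" +
  fixes X :: "nat \<Rightarrow> 'a \<Rightarrow> real" and f :: "real \<Rightarrow> ennreal"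
  assumes indep: "indep_vars (\<lambda>_. borel) X {1..}"
    and dens: "\<And>p. 1 \<le> p \<Longrightarrow> distributed M lborel (X p) f"
begin

lemma X_measurable: "1 \<le> p \<Longrightarrow> X p \<in> borel_measurable M"
  using distributed_measurable[OF dens] by simp

lemma order_stat_rv:
  "1 \<le> k \<Longrightarrow> k \<le> N \<Longrightarrow> order_stat (\<lambda>p. X (r + p)) k N \<in> borel_measurable M"
  by (intro measurable_order_stat X_measurable) auto

lemma order_stat_rv0: "1 \<le> k \<Longrightarrow> k \<le> N \<Longrightarrow> order_stat X k N \<in> borel_measurable M"
  using order_stat_rv[where r = 0] by simp

lemma pair_distributed:
  assumes pq: "1 \<le> p" "1 \<le> q" "p \<noteq> q"
  shows "distributed M lborel (\<lambda>\<omega>. (X p \<omega>, X q \<omega>)) (\<lambda>(x, y). f x * f y)"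
proof -
  have "indep_var borel ((\<lambda>x. x p) \<circ> (\<lambda>\<omega>. restrict (\<lambda>i. X i \<omega>) {p}))
        borel ((\<lambda>x. x q) \<circ> (\<lambda>\<omega>. restrict (\<lambda>i. X i \<omega>) {q}))"
    using pq by (intro indep_var_compose[OF indep_var_restrict[OF indep]]) auto
  then have "indep_var borel (X p) borel (X q)" by (simp add: comp_def)
  then have "indep_var lborel (X p) lborel (X q)"
    unfolding indep_var_eq by simp
  then have "distributed M (lborel \<Otimes>\<^sub>M lborel) (\<lambda>\<omega>. (X p \<omega>, X q \<omega>)) (\<lambda>(x, y). f x * f y)"
    using dens pq by (intro distributed_joint_indep lborel.sigma_finite_measure_axioms) auto
  then show ?thesis by (simp add: lborel_prod)
qed

text \<open>By independence the pair has a density on the plane. Applied to the diagonal this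
  excludes ties; applied to an arbitrary null set it yields joint densities of order
  statistics.\<close>

lemma AE_pair:
  assumes pq: "1 \<le> p" "1 \<le> q" "p \<noteq> q" and S: "S \<in> null_sets lborel"
  shows "AE \<omega> in M. (X p \<omega>, X q \<omega>) \<notin> S"
proof -
  have "AE z in density lborel (\<lambda>(x, y). f x * f y). z \<notin> S"
    using AE_not_in[OF S] distributed_borel_measurable[OF pair_distributed[OF pq]]
    by (subst AE_density) auto
  then show ?thesis
    using distributed_AE2[OF pair_distributed[OF pq], of "\<lambda>z. z \<notin> S"] S
     distributed_borel_measurable[OF pair_distributed[OF pq]]
    by (auto simp: AE_density pred_def null_sets_def)
qed

end

text \<open>By Fubini, since each section of the diagonal is a single point.\<close>

lemma null_sets_diagonal: "{z :: real \<times> real. fst z = snd z} \<in> null_sets lborel"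
proof -
  let ?D = "{z :: real \<times> real. fst z = snd z}"
  have D: "?D \<in> sets borel" by (intro borel_closed closed_Collect_eq continuous_intros)
  then have D': "?D \<in> sets (lborel \<Otimes>\<^sub>M lborel)" unfolding lborel_prod by simp
  have "emeasure (lborel \<Otimes>\<^sub>M lborel) ?D = (\<integral>\<^sup>+x. emeasure lborel (Pair x -` ?D) \<partial>lborel)"
    by (rule lborel.emeasure_pair_measure_alt[OF D'])
  also have "\<dots> = (\<integral>\<^sup>+x. 0 \<partial>(lborel :: real measure))"
  proof (rule nn_integral_cong)
    fix x :: real
    have "Pair x -` ?D = {x}" by auto
    then show "emeasure lborel (Pair x -` ?D) = 0" by simp
  qed
  finally show ?thesis using D by (intro null_setsI) (simp_all add: lborel_prod)
qed

section \<open>The random order of the sample and its independence of the ordered values\<close>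

context iid_density
begin

lemma AE_inj: "AE \<omega> in M. inj_on (\<lambda>p. X p \<omega>) {1..N}"
proof -
  have "AE \<omega> in M. p \<noteq> q \<longrightarrow> X p \<omega> \<noteq> X q \<omega>" if "p \<in> {1..N}" "q \<in> {1..N}" for p q
    using AE_pair[OF _ _ _ null_sets_diagonal, of p q] that by (cases "p = q") auto
  then have "AE \<omega> in M. \<forall>p\<in>{1..N}. \<forall>q\<in>{1..N}. p \<noteq> q \<longrightarrow> X p \<omega> \<noteq> X q \<omega>"
    by (intro AE_finite_allI) auto
  then show ?thesis by eventually_elim (auto simp: inj_on_def)
qed

text \<open>Strict inequalities make the ordering permutation unique; at a tie there is none, which
  happens only on a null set.\<close>

definition ordered_by :: "nat list \<Rightarrow> 'a \<Rightarrow> bool" where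
  "ordered_by ys \<omega> \<longleftrightarrow> sorted_wrt (<) (map (\<lambda>p. X p \<omega>) ys)"

lemma ordered_by_alt: "ordered_by ys \<omega> \<longleftrightarrow>
    (\<forall>a\<in>{..<length ys}. \<forall>b\<in>{a<..<length ys}. X (ys ! a) \<omega> < X (ys ! b) \<omega>)"
  unfolding ordered_by_def sorted_wrt_iff_nth_less by auto

lemma order_stat_ordered_by:
  assumes "ys \<in> permutations_of_set {1..N}" "ordered_by ys \<omega>" "1 \<le> k" "k \<le> N"
  shows "order_stat X k N \<omega> = X (ys ! (k - 1)) \<omega>"
  using assms unfolding ordered_by_def by (intro order_stat_full)

lemma permutation_index:
  assumes "ys \<in> permutations_of_set {1..N}" "a < N"
  shows "1 \<le> ys ! a" "ys ! a \<le> N"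
proof -
  have "ys ! a \<in> set ys" using assms length_finite_permutations_of_set[OF assms(1)] by (intro nth_mem) simp
  then show "1 \<le> ys ! a" "ys ! a \<le> N" using permutations_of_setD(1)[OF assms(1)] by auto
qed

lemma ordered_by_measurable[measurable]:
  assumes ys: "ys \<in> permutations_of_set {1..N}"
  shows "Measurable.pred M (ordered_by ys)"
proof -
  have len: "length ys = N" using length_finite_permutations_of_set[OF ys] by simp
  have "Measurable.pred M (\<lambda>\<omega>. X (ys ! a) \<omega> < X (ys ! b) \<omega>)" if "a < N" "b < N" for a b
  proof -
    have [measurable]: "X (ys ! a) \<in> borel_measurable M" "X (ys ! b) \<in> borel_measurable M"
      using permutation_index[OF ys] that by (auto intro: X_measurable)
    show ?thesis by measurable
  qed
  then show ?thesis unfolding ordered_by_alt[abs_def] len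
    by (intro pred_intros_finite) auto
qed

lemma ordered_by_unique:
  assumes "ordered_by xs \<omega>" "ordered_by ys \<omega>" "xs \<in> permutations_of_set P" "ys \<in> permutations_of_set P"
  shows "xs = ys"
  using assms sorted_permutation_unique[of "\<lambda>p. X p \<omega>" xs ys]
  by (simp add: ordered_by_def permutations_of_setD(1))

lemma AE_ordered_by: "AE \<omega> in M. \<exists>!ys. ys \<in> permutations_of_set {1..N} \<and> ordered_by ys \<omega>"
  using AE_inj[of N]
proof eventually_elim
  case (elim \<omega>)
  then show ?case using sorted_permutation_exists[OF elim] ordered_by_unique[of _ \<omega> _ "{1..N}"]
    unfolding ordered_by_def by blast
qed

text \<open>Up to a null set, the events \<open>ordered_by ys\<close> form a finite partition of the
  probability space.\<close>

lemma prob_split_ordered: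
  assumes "{\<omega> \<in> space M. Q \<omega>} \<in> events"
  shows "\<P>(\<omega> in M. Q \<omega>) =
    (\<Sum>ys\<in>permutations_of_set {1..N}. \<P>(\<omega> in M. ordered_by ys \<omega> \<and> Q \<omega>))"
proof (rule prob_sum)
  show "{\<omega> \<in> space M. ordered_by ys \<omega> \<and> Q \<omega>} \<in> events" if "ys \<in> permutations_of_set {1..N}" for ys
    using assms ordered_by_measurable[OF that] by (intro sets.sets_Collect_conj) (auto simp: pred_def)
  show "AE \<omega> in M. (\<forall>ys\<in>permutations_of_set {1..N}. ordered_by ys \<omega> \<and> Q \<omega> \<longrightarrow> Q \<omega>) \<and>
    (Q \<omega> \<longrightarrow> (\<exists>!ys\<in>permutations_of_set {1..N}. ordered_by ys \<omega> \<and> Q \<omega>))"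
    using AE_ordered_by[of N] by eventually_elim auto
qed (use assms in auto)

text \<open>Exchangeability: the joint law is a product of equal factors, and the entries of ys
  merely relabel the coordinates by a bijection from \<open>{..<N}\<close> to \<open>{1..N}\<close>.
  The right-hand side does not depend on ys.\<close>

lemma distr_permuted:
  assumes ys: "ys \<in> permutations_of_set {1..N}" and N: "1 \<le> N"
  shows "distr M (Pi\<^sub>M {..<N} (\<lambda>_. borel)) (\<lambda>\<omega>. \<lambda>a\<in>{..<N}. X (ys ! a) \<omega>) =
    Pi\<^sub>M {..<N} (\<lambda>_. density lborel f)"
proof -
  let ?\<mu> = "density lborel f"
  have len: "length ys = N" using length_finite_permutations_of_set[OF ys] by simp
  have y: "set ys = {1..N}" "distinct ys" using permutations_of_setD[OF ys] by auto
  have D: "distr M borel (X p) = ?\<mu>" if "1 \<le> p" for p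
    using distributed_distr_eq_density[OF dens[OF that]] distr_cong[of M M borel lborel "X p" "X p"] by simp
  have sp: "sets (Pi\<^sub>M K (\<lambda>_. borel)) = sets (Pi\<^sub>M K (\<lambda>_. ?\<mu>))" for K :: "nat set"
    by (intro sets_PiM_cong) auto
  interpret \<mu>: prob_space ?\<mu>
    unfolding D[OF order_refl, symmetric] by (intro prob_space_distr X_measurable) simp
  have "indep_vars (\<lambda>_. borel) X {1..N}"
    using indep by (rule indep_vars_subset) auto
  then have "distr M (Pi\<^sub>M {1..N} (\<lambda>_. borel)) (\<lambda>\<omega>. \<lambda>p\<in>{1..N}. X p \<omega>) = Pi\<^sub>M {1..N} (\<lambda>p. distr M borel (X p))"
    using N by (subst (asm) indep_vars_iff_distr_eq_PiM') (auto intro: X_measurable)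
  also have "\<dots> = Pi\<^sub>M {1..N} (\<lambda>_. ?\<mu>)" by (intro PiM_cong D) auto
  finally have joint: "distr M (Pi\<^sub>M {1..N} (\<lambda>_. borel)) (\<lambda>\<omega>. \<lambda>p\<in>{1..N}. X p \<omega>) = Pi\<^sub>M {1..N} (\<lambda>_. ?\<mu>)" .
  have maps: "(!) ys ` {..<N} = {1..N}" "inj_on ((!) ys) {..<N}"
    using y len by (auto simp: set_conv_nth inj_on_nth image_def)
  have m1: "(\<lambda>\<omega>. \<lambda>p\<in>{1..N}. X p \<omega>) \<in> measurable M (Pi\<^sub>M {1..N} (\<lambda>_. borel))"
    by (intro measurable_restrict X_measurable) auto
  have m2: "(\<lambda>x. \<lambda>a\<in>{..<N}. x (ys ! a)) \<in> measurable (Pi\<^sub>M {1..N} (\<lambda>_. borel)) (Pi\<^sub>M {..<N} (\<lambda>_. borel :: real measure))"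
    using maps by (intro measurable_restrict measurable_component_singleton) auto
  have "Pi\<^sub>M {..<N} (\<lambda>_. ?\<mu>) = distr (Pi\<^sub>M {1..N} (\<lambda>_. ?\<mu>)) (Pi\<^sub>M {..<N} (\<lambda>_. ?\<mu>)) (\<lambda>x. \<lambda>a\<in>{..<N}. x (ys ! a))"
    using maps \<mu>.prob_space_axioms by (intro distr_PiM_reindex[symmetric]) auto
  also have "\<dots> = distr (distr M (Pi\<^sub>M {1..N} (\<lambda>_. borel)) (\<lambda>\<omega>. \<lambda>p\<in>{1..N}. X p \<omega>)) (Pi\<^sub>M {..<N} (\<lambda>_. borel)) (\<lambda>x. \<lambda>a\<in>{..<N}. x (ys ! a))"
    unfolding joint by (intro distr_cong sp[symmetric] refl)
  also have "\<dots> = distr M (Pi\<^sub>M {..<N} (\<lambda>_. borel)) ((\<lambda>x. \<lambda>a\<in>{..<N}. x (ys ! a)) \<circ> (\<lambda>\<omega>. \<lambda>p\<in>{1..N}. X p \<omega>))"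
    by (rule distr_distr[OF m2 m1])
  also have "(\<lambda>x. \<lambda>a\<in>{..<N}. x (ys ! a)) \<circ> (\<lambda>\<omega>. \<lambda>p\<in>{1..N}. X p \<omega>) = (\<lambda>\<omega>. \<lambda>a\<in>{..<N}. X (ys ! a) \<omega>)"
    using maps(1) by (auto simp: fun_eq_iff)
  finally show ?thesis by (rule sym)
qed

text \<open>In terms of the vector rearranged by ys, both conditions say that it lies in a fixed set
  which does not mention ys: increasing coordinates, with coordinates a and b forming a point of S.
  The rearranged vectors have the same law.\<close>

lemma prob_ordered_by_eq:
  fixes S :: "(real \<times> real) set"
  assumes ys: "ys \<in> permutations_of_set {1..N}" and zs: "zs \<in> permutations_of_set {1..N}"
    and N: "1 \<le> N" and ab: "a < N" "b < N" and S: "S \<in> sets borel"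
  shows "\<P>(\<omega> in M. ordered_by ys \<omega> \<and> (X (ys ! a) \<omega>, X (ys ! b) \<omega>) \<in> S) =
    \<P>(\<omega> in M. ordered_by zs \<omega> \<and> (X (zs ! a) \<omega>, X (zs ! b) \<omega>) \<in> S)"
proof -
  let ?P = "Pi\<^sub>M {..<N} (\<lambda>_. borel :: real measure)"
  let ?\<Phi> = "{x \<in> space ?P. (\<forall>c\<in>{..<N}. \<forall>d\<in>{c<..<N}. x c < x d) \<and> (x a, x b) \<in> S}"
  have [measurable]: "S \<in> sets (borel \<Otimes>\<^sub>M borel)" using S unfolding borel_prod .
  have comp: "(\<lambda>x. x c) \<in> borel_measurable ?P" if "c < N" for c
    using that by (intro measurable_component_singleton) auto
  have "Measurable.pred ?P (\<lambda>x. x c < x d)" if "c < N" "d < N" for c d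
  proof -
    note [measurable] = comp[OF that(1)] comp[OF that(2)]
    show ?thesis by measurable
  qed
  then have "Measurable.pred ?P (\<lambda>x. \<forall>c\<in>{..<N}. \<forall>d\<in>{c<..<N}. x c < x d)"
    by (intro pred_intros_finite) auto
  moreover have "Measurable.pred ?P (\<lambda>x. (x a, x b) \<in> S)"
  proof -
    note [measurable] = comp[OF ab(1)] comp[OF ab(2)]
    show ?thesis by measurable
  qed
  ultimately have \<Phi>: "?\<Phi> \<in> sets ?P" unfolding pred_def by (intro sets.sets_Collect_conj) auto
  have "\<P>(\<omega> in M. ordered_by us \<omega> \<and> (X (us ! a) \<omega>, X (us ! b) \<omega>) \<in> S) =
      measure (Pi\<^sub>M {..<N} (\<lambda>_. density lborel f)) ?\<Phi>" if us: "us \<in> permutations_of_set {1..N}" for us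
  proof -
    have len: "length us = N" using length_finite_permutations_of_set[OF us] by simp
    have m: "(\<lambda>\<omega>. \<lambda>a\<in>{..<N}. X (us ! a) \<omega>) \<in> measurable M ?P"
      using permutation_index[OF us] by (intro measurable_restrict X_measurable) auto
    have "measure (distr M ?P (\<lambda>\<omega>. \<lambda>a\<in>{..<N}. X (us ! a) \<omega>)) ?\<Phi> =
      prob ((\<lambda>\<omega>. \<lambda>a\<in>{..<N}. X (us ! a) \<omega>) -` ?\<Phi> \<inter> space M)"
      by (rule measure_distr[OF m \<Phi>])
    also have "(\<lambda>\<omega>. \<lambda>a\<in>{..<N}. X (us ! a) \<omega>) -` ?\<Phi> \<inter> space M =
      {\<omega> \<in> space M. ordered_by us \<omega> \<and> (X (us ! a) \<omega>, X (us ! b) \<omega>) \<in> S}"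
      using ab len by (auto simp: ordered_by_alt space_PiM)
    finally show ?thesis unfolding distr_permuted[OF us N] by simp
  qed
  then show ?thesis using ys zs by simp
qed

text \<open>The N! orders contribute equal terms to the partition of the event on the right. On
  \<open>ordered_by us\<close> the order statistics are the entries of the rearranged
  vector.\<close>

lemma prob_ordered_by:
  fixes S :: "(real \<times> real) set"
  assumes ys: "ys \<in> permutations_of_set {1..N}"
    and k: "1 \<le> k" "k \<le> N" and l: "1 \<le> l" "l \<le> N" and S: "S \<in> sets borel"
  shows "\<P>(\<omega> in M. ordered_by ys \<omega> \<and> (order_stat X k N \<omega>, order_stat X l N \<omega>) \<in> S) =
    \<P>(\<omega> in M. (order_stat X k N \<omega>, order_stat X l N \<omega>) \<in> S) / fact N"
proof -
  let ?E = "\<lambda>us \<omega>. ordered_by us \<omega> \<and> (order_stat X k N \<omega>, order_stat X l N \<omega>) \<in> S"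
  have [measurable]: "order_stat X k N \<in> borel_measurable M" "order_stat X l N \<in> borel_measurable M"
    using k l by (simp_all add: order_stat_rv0)
  have [measurable]: "S \<in> sets (borel \<Otimes>\<^sub>M borel)" using S unfolding borel_prod .
  have E: "?E us \<omega> \<longleftrightarrow> ordered_by us \<omega> \<and> (X (us ! (k - 1)) \<omega>, X (us ! (l - 1)) \<omega>) \<in> S"
    if "us \<in> permutations_of_set {1..N}" for us \<omega>
    using order_stat_ordered_by[OF that _ k] order_stat_ordered_by[OF that _ l] by auto
  have eq: "\<P>(\<omega> in M. ?E us \<omega>) = \<P>(\<omega> in M. ?E ys \<omega>)" if us: "us \<in> permutations_of_set {1..N}" for us
    unfolding E[OF us] E[OF ys] using k l S by (intro prob_ordered_by_eq[OF us ys]) auto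
  have "\<P>(\<omega> in M. (order_stat X k N \<omega>, order_stat X l N \<omega>) \<in> S) =
      (\<Sum>us\<in>permutations_of_set {1..N}. \<P>(\<omega> in M. ?E us \<omega>))"
    by (rule prob_split_ordered) measurable
  also have "\<dots> = (\<Sum>us\<in>permutations_of_set {1..N}. \<P>(\<omega> in M. ?E ys \<omega>))"
    by (rule sum.cong[OF refl eq])
  finally show ?thesis by simp
qed

text \<open>On \<open>ordered_by ys\<close> the two equalities hold exactly if ys lies in
  \<open>rank_lists\<close>. Each such ys contributes the fraction 1 / N! of the probability on the
  right, where N = n + r.\<close>

lemma prob_ranks:
  fixes S :: "(real \<times> real) set"
  assumes r: "r < m" "m \<le> n" and i: "1 \<le> i" "i \<le> m" and j: "1 \<le> j" "j \<le> n"
    and k: "1 \<le> k" "k \<le> n + r" and l: "1 \<le> l" "l \<le> n + r" and S: "S \<in> sets borel"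
  shows "\<P>(\<omega> in M. (order_stat X i m \<omega> = order_stat X k (n + r) \<omega> \<and>
      shifted_order_stat X r j n \<omega> = order_stat X l (n + r) \<omega>) \<and>
      (order_stat X k (n + r) \<omega>, order_stat X l (n + r) \<omega>) \<in> S) =
    real (card (rank_lists {1..r} {r + 1..m} {m + 1..n + r} i k j l)) / fact (n + r) *
    \<P>(\<omega> in M. (order_stat X k (n + r) \<omega>, order_stat X l (n + r) \<omega>) \<in> S)"
proof -
  let ?N = "n + r"
  let ?R = "rank_lists {1..r} {r + 1..m} {m + 1..n + r} i k j l"
  let ?V = "\<lambda>\<omega>. (order_stat X k ?N \<omega>, order_stat X l ?N \<omega>)"
  let ?E = "\<lambda>\<omega>. order_stat X i m \<omega> = order_stat X k (n + r) \<omega> \<and>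
      shifted_order_stat X r j n \<omega> = order_stat X l (n + r) \<omega>"
  have [measurable]: "order_stat X k ?N \<in> borel_measurable M" "order_stat X l ?N \<in> borel_measurable M"
    "order_stat X i m \<in> borel_measurable M" "shifted_order_stat X r j n \<in> borel_measurable M"
    using i j k l by (simp_all add: order_stat_rv0 order_stat_rv)
  have [measurable]: "S \<in> sets (borel \<Otimes>\<^sub>M borel)" using S unfolding borel_prod .
  have U: "{1..r} \<union> {r + 1..m} \<union> {m + 1..n + r} = {1..?N}" "{1..r} \<union> {r + 1..m} = {1..m}"
    "{r + 1..m} \<union> {m + 1..n + r} = {r + 1..r + n}" using r by auto
  have sub: "?R \<subseteq> permutations_of_set {1..?N}" unfolding rank_lists_def U(1) by blast
  have E: "?E \<omega> \<longleftrightarrow> ys \<in> ?R" if ys: "ys \<in> permutations_of_set {1..?N}" and o: "ordered_by ys \<omega>" for ys \<omega>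
  proof -
    note o' = o[unfolded ordered_by_def]
    have "order_stat X i m \<omega> = X (ys ! (k - 1)) \<omega> \<longleftrightarrow>
      ys ! (k - 1) \<in> {1..m} \<and> card (set (take (k - 1) ys) \<inter> {1..m}) = i - 1"
      using order_stat_shift_eq_iff[where X = X and \<omega> = \<omega> and r = 0 and n = m and i = i, OF o' ys _ i k] r
      by simp
    moreover have "shifted_order_stat X r j n \<omega> = X (ys ! (l - 1)) \<omega> \<longleftrightarrow>
      ys ! (l - 1) \<in> {r + 1..r + n} \<and> card (set (take (l - 1) ys) \<inter> {r + 1..r + n}) = j - 1"
      by (rule order_stat_shift_eq_iff[where X = X and \<omega> = \<omega> and r = r and n = n and i = j, OF o' ys _ j l]) simp
    ultimately show ?thesis
      unfolding order_stat_ordered_by[OF ys o k] order_stat_ordered_by[OF ys o l] rank_lists_def U(1)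
      unfolding U(2,3) using ys by blast
  qed
  have "\<P>(\<omega> in M. ?E \<omega> \<and> ?V \<omega> \<in> S) =
      (\<Sum>ys\<in>permutations_of_set {1..?N}. \<P>(\<omega> in M. ordered_by ys \<omega> \<and> ?E \<omega> \<and> ?V \<omega> \<in> S))"
    by (rule prob_split_ordered) measurable
  also have "\<dots> = (\<Sum>ys\<in>permutations_of_set {1..?N}. if ys \<in> ?R then \<P>(\<omega> in M. ?V \<omega> \<in> S) / fact ?N else 0)"
  proof (rule sum.cong[OF refl])
    fix ys assume ys: "ys \<in> permutations_of_set {1..?N}"
    have "ordered_by ys \<omega> \<and> ?E \<omega> \<and> ?V \<omega> \<in> S \<longleftrightarrow> ys \<in> ?R \<and> ordered_by ys \<omega> \<and> ?V \<omega> \<in> S" for \<omega>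
      using E[OF ys] by blast
    then show "\<P>(\<omega> in M. ordered_by ys \<omega> \<and> ?E \<omega> \<and> ?V \<omega> \<in> S) =
      (if ys \<in> ?R then \<P>(\<omega> in M. ?V \<omega> \<in> S) / fact ?N else 0)"
      using prob_ordered_by[OF ys k l S] by simp
  qed
  also have "\<dots> = (\<Sum>ys\<in>?R. \<P>(\<omega> in M. ?V \<omega> \<in> S) / fact ?N)"
    using sub by (subst sum.If_cases) (auto intro!: sum.cong simp: Int_absorb1)
  finally show ?thesis by simp
qed

text \<open>The case S = UNIV, where the last probability is 1. Inserted into
  \<open>prob_ranks\<close> for general S, it expresses independence of the rank event and the
  ordered values.\<close>

lemma coef_eq:
  assumes "r < m" "m \<le> n" "1 \<le> i" "i \<le> m" "1 \<le> j" "j \<le> n" "1 \<le> k" "k \<le> n + r" "1 \<le> l" "l \<le> n + r"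
  shows "coef M X r i m k j n l =
    real (card (rank_lists {1..r} {r + 1..m} {m + 1..n + r} i k j l)) / fact (n + r)"
  using prob_ranks[OF assms, of UNIV] prob_space unfolding coef_def by simp

end

section \<open>Integration with respect to the sum of plane and diagonal Lebesgue measure\<close>

lemma diagonal_measurable: "(\<lambda>x::real. (x, x)) \<in> measurable borel borel"
  by (intro borel_measurable_Pair) simp_all

text \<open>For indicators this is the definition of \<open>nu\<close>; scaling, sums and increasing
  limits extend it to all nonnegative Borel functions.\<close>

lemma nn_integral_nu:
  assumes "F \<in> borel_measurable borel"
  shows "(\<integral>\<^sup>+z. F z \<partial>nu) = (\<integral>\<^sup>+z. F z \<partial>lborel) + (\<integral>\<^sup>+x. F (x, x) \<partial>lborel)"
  using assms
proof (induction rule: borel_measurable_induct)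
  case (cong f g)
  then show ?case by (metis (no_types, lifting) UNIV_I nn_integral_cong space_borel)
next
  case (set A)
  have "(\<integral>\<^sup>+x. indicator A (x, x) \<partial>lborel) = (\<integral>\<^sup>+x. indicator {x. (x, x) \<in> A} x \<partial>lborel)"
    by (simp add: indicator_def)
  also have "\<dots> = emeasure lborel {x. (x, x) \<in> A}"
  proof (rule nn_integral_indicator)
    from measurable_sets[OF diagonal_measurable set] show "{x. (x, x) \<in> A} \<in> sets lborel" by (simp add: vimage_def)
  qed
  finally show ?case using set by (simp add: emeasure_nu)
next
  case (mult u c)
  have [measurable]: "u \<in> borel_measurable borel" by fact
  have [measurable]: "(\<lambda>x. u (x, x)) \<in> borel_measurable lborel"
    by (intro measurable_compose[OF _ mult(2)] borel_measurable_Pair) simp_all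
  have [measurable]: "u \<in> borel_measurable nu" using mult(2) by (simp cong: measurable_cong_sets)
  show ?case using mult by (simp add: nn_integral_cmult distrib_left)
next
  case (add u v)
  have u[measurable]: "u \<in> borel_measurable borel" and v[measurable]: "v \<in> borel_measurable borel" by fact+
  have [measurable]: "(\<lambda>x. u (x, x)) \<in> borel_measurable lborel" "(\<lambda>x. v (x, x)) \<in> borel_measurable lborel"
    by (intro measurable_compose[OF _ u] measurable_compose[OF _ v] borel_measurable_Pair; simp)+
  have [measurable]: "u \<in> borel_measurable nu" "v \<in> borel_measurable nu"
    using u v by (simp_all cong: measurable_cong_sets)
  show ?case using add by (simp add: nn_integral_add ac_simps)
next
  case (seq U)
  have U[measurable]: "U i \<in> borel_measurable borel" for i by fact
  have [measurable]: "(\<lambda>x. U i (x, x)) \<in> borel_measurable lborel" for i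
    by (intro measurable_compose[OF _ U] borel_measurable_Pair) simp_all
  have [measurable]: "U i \<in> borel_measurable nu" for i
    using U by (simp cong: measurable_cong_sets)
  have inc: "incseq (\<lambda>i x. U i (x, x))" using seq by (auto simp: incseq_def le_fun_def)
  have sup: "(\<lambda>z. (SUP i. U i) z) = (\<lambda>z. SUP i. U i z)" by (simp add: fun_eq_iff image_comp)
  have mono: "incseq (\<lambda>i. \<integral>\<^sup>+z. U i z \<partial>lborel)" "incseq (\<lambda>i. \<integral>\<^sup>+x. U i (x, x) \<partial>lborel)"
    using seq inc by (auto simp: incseq_def le_fun_def intro!: nn_integral_mono)
  have "(\<integral>\<^sup>+z. (SUP i. U i) z \<partial>nu) = (SUP i. \<integral>\<^sup>+z. U i z \<partial>nu)"
    unfolding sup using seq by (intro nn_integral_monotone_convergence_SUP) auto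
  also have "\<dots> = (SUP i. (\<integral>\<^sup>+z. U i z \<partial>lborel) + (\<integral>\<^sup>+x. U i (x, x) \<partial>lborel))"
    using seq by simp
  also have "\<dots> = (SUP i. \<integral>\<^sup>+z. U i z \<partial>lborel) + (SUP i. \<integral>\<^sup>+x. U i (x, x) \<partial>lborel)"
    by (rule ennreal_SUP_add[OF mono])
  also have "(SUP i. \<integral>\<^sup>+z. U i z \<partial>lborel) = (\<integral>\<^sup>+z. (SUP i. U i) z \<partial>lborel)"
    unfolding sup using seq by (intro nn_integral_monotone_convergence_SUP[symmetric]) auto
  also have "(SUP i. \<integral>\<^sup>+x. U i (x, x) \<partial>lborel) = (\<integral>\<^sup>+x. (SUP i. U i) (x, x) \<partial>lborel)"
    unfolding sup using inc by (intro nn_integral_monotone_convergence_SUP[symmetric]) auto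
  finally show ?case .
qed

lemma joint_density_measurable:
  assumes d: "order_stat_densities M X N g h" and k: "k \<in> {1..N}" and l: "l \<in> {1..N}"
  shows "(\<lambda>(x, y). joint_density g h k l x y) \<in> borel_measurable borel"
proof (cases "k = l")
  case True
  have [measurable]: "g k \<in> borel_measurable borel"
    using d k distributed_borel_measurable[of M lborel "order_stat X k N" "g k"]
    by (auto simp: order_stat_densities_def)
  have [measurable]: "{z :: real \<times> real. fst z = snd z} \<in> sets (borel \<Otimes>\<^sub>M borel)"
    using null_sets_diagonal unfolding null_sets_def borel_prod by simp
  have "(\<lambda>z. if z \<in> {z :: real \<times> real. fst z = snd z} then g k (fst z) else 0) \<in> borel_measurable (borel \<Otimes>\<^sub>M borel)"
    by measurable
  also have "(\<lambda>z. if z \<in> {z :: real \<times> real. fst z = snd z} then g k (fst z) else 0) = (\<lambda>(x, y). joint_density g h k l x y)"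
    using True by (auto simp: fun_eq_iff joint_density_def)
  finally show ?thesis by (simp add: borel_prod)
next
  case False
  then have "distributed M lborel (\<lambda>\<omega>. (order_stat X k N \<omega>, order_stat X l N \<omega>)) (h k l)"
    using d k l by (auto simp: order_stat_densities_def)
  then have "h k l \<in> borel_measurable borel"
    using distributed_borel_measurable by fastforce
  also have "h k l = (\<lambda>(x, y). joint_density g h k l x y)"
    using False by (auto simp: fun_eq_iff joint_density_def)
  finally show ?thesis .
qed

text \<open>For k = l the plane integral is 0, because the integrand lives on the null diagonal, and
  the diagonal integral is that of the density of a single order statistic. For k \<noteq> l the
  diagonal integral is 0 by the normalisation of h, and the plane integral gives the joint
  law.\<close>

lemma nn_integral_joint_density:
  assumes d: "order_stat_densities M X N g h" and k: "k \<in> {1..N}" and l: "l \<in> {1..N}"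
    and S: "S \<in> sets borel"
  shows "(\<integral>\<^sup>+z. (case z of (x, y) \<Rightarrow> joint_density g h k l x y) * indicator S z \<partial>nu) =
    emeasure M ({\<omega> \<in> space M. (order_stat X k N \<omega>, order_stat X l N \<omega>) \<in> S})"
proof -
  have m: "(\<lambda>z. (case z of (x, y) \<Rightarrow> joint_density g h k l x y) * indicator S z) \<in> borel_measurable borel"
    using joint_density_measurable[OF d k l] S by (intro borel_measurable_times_ennreal) auto
  show ?thesis
  proof (cases "k = l")
    case True
    have D: "distributed M lborel (order_stat X k N) (g k)"
      using d k by (auto simp: order_stat_densities_def)
    have "AE z in lborel. z \<notin> {z :: real \<times> real. fst z = snd z}" by (rule AE_not_in[OF null_sets_diagonal])
    then have "(\<integral>\<^sup>+z. (case z of (x, y) \<Rightarrow> joint_density g h k l x y) * indicator S z \<partial>lborel) = (\<integral>\<^sup>+z. 0 \<partial>(lborel :: (real \<times> real) measure))"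
      using True by (intro nn_integral_cong_AE) (auto simp: joint_density_def elim!: eventually_mono)
    moreover have SD: "{x. (x, x) \<in> S} \<in> sets lborel"
      using measurable_sets[OF diagonal_measurable S] by (simp add: vimage_def)
    moreover have "(\<integral>\<^sup>+x. joint_density g h k l x x * indicator S (x, x) \<partial>lborel) = emeasure M (order_stat X k N -` {x. (x, x) \<in> S} \<inter> space M)"
      unfolding distributed_emeasure[OF D SD] using True
      by (intro nn_integral_cong) (auto simp: joint_density_def indicator_def)
    moreover have "order_stat X k N -` {x. (x, x) \<in> S} \<inter> space M = {\<omega> \<in> space M. (order_stat X k N \<omega>, order_stat X l N \<omega>) \<in> S}"
      using True by auto
    ultimately show ?thesis unfolding nn_integral_nu[OF m] by simp
  next
    case False
    have D: "distributed M lborel (\<lambda>\<omega>. (order_stat X k N \<omega>, order_stat X l N \<omega>)) (h k l)"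
      and 0: "h k l (x, x) = 0" for x
      using d k l False by (auto simp: order_stat_densities_def)
    have "(\<integral>\<^sup>+z. (case z of (x, y) \<Rightarrow> joint_density g h k l x y) * indicator S z \<partial>lborel) =
       (\<integral>\<^sup>+z. h k l z * indicator S z \<partial>lborel)"
      using False by (intro nn_integral_cong) (auto simp: joint_density_def)
    also have "\<dots> = emeasure M ((\<lambda>\<omega>. (order_stat X k N \<omega>, order_stat X l N \<omega>)) -` S \<inter> space M)"
      using distributed_emeasure[OF D, of S] S by simp
    also have "(\<lambda>\<omega>. (order_stat X k N \<omega>, order_stat X l N \<omega>)) -` S \<inter> space M = {\<omega> \<in> space M. (order_stat X k N \<omega>, order_stat X l N \<omega>) \<in> S}"
      by auto
    finally have 1: "(\<integral>\<^sup>+z. (case z of (x, y) \<Rightarrow> joint_density g h k l x y) * indicator S z \<partial>lborel) =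
      emeasure M {\<omega> \<in> space M. (order_stat X k N \<omega>, order_stat X l N \<omega>) \<in> S}" .
    have 2: "(\<integral>\<^sup>+x. (case (x, x) of (x, y) \<Rightarrow> joint_density g h k l x y) * indicator S (x, x) \<partial>lborel) = 0"
      using False by (simp add: joint_density_def 0)
    show ?thesis unfolding nn_integral_nu[OF m] 1 2 by simp
  qed
qed

section \<open>Existence of the densities of order statistics\<close>

text \<open>Radon-Nikodym: a variable that almost surely avoids each null set has an absolutely
  continuous law.\<close>

lemma distributed_RN_deriv_lborel:
  fixes Y :: "'a \<Rightarrow> 'b::euclidean_space"
  assumes Y: "Y \<in> borel_measurable M"
    and null: "\<And>S. S \<in> null_sets lborel \<Longrightarrow> AE \<omega> in M. Y \<omega> \<notin> S"
  shows "distributed M lborel Y (RN_deriv lborel (distr M lborel Y))"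
proof -
  have ac: "absolutely_continuous lborel (distr M lborel Y)"
    unfolding absolutely_continuous_def
  proof
    fix S :: "'b set" assume S: "S \<in> null_sets lborel"
    then have S': "S \<in> sets borel" by (simp add: null_sets_def)
    have "AE \<omega> in M. \<omega> \<notin> Y -` S \<inter> space M" using null[OF S] by eventually_elim auto
    then have "emeasure M (Y -` S \<inter> space M) = 0"
      using Y S' by (subst (asm) AE_iff_null_sets[symmetric]) (auto intro: measurable_sets)
    then show "S \<in> null_sets (distr M lborel Y)"
      using Y S' by (intro null_setsI) (simp_all add: emeasure_distr)
  qed
  have "density lborel (RN_deriv lborel (distr M lborel Y)) = distr M lborel Y"
    by (rule sigma_finite_measure.density_RN_deriv[OF lborel.sigma_finite_measure_axioms ac]) simp
  then show ?thesis using Y by (simp add: distributed_def)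
qed

context iid_density
begin

text \<open>The order statistic always equals one of finitely many observations, each of which
  almost surely avoids a given null set.\<close>

lemma order_stat_distributed:
  assumes "1 \<le> k" "k \<le> N"
  shows "distributed M lborel (order_stat X k N) (RN_deriv lborel (distr M lborel (order_stat X k N)))"
proof (rule distributed_RN_deriv_lborel)
  show "order_stat X k N \<in> borel_measurable M" using assms by (rule order_stat_rv0)
  fix S :: "real set" assume S: "S \<in> null_sets lborel"
  have "AE \<omega> in M. X p \<omega> \<notin> S" if "p \<in> {1..N}" for p
  proof -
    have "AE z in density lborel f. z \<notin> S"
      using AE_not_in[OF S] distributed_borel_measurable[OF dens] that by (subst AE_density) auto
    moreover have "distr M lborel (X p) = density lborel f"
      using that by (intro distributed_distr_eq_density dens) simp
    ultimately have "AE z in distr M lborel (X p). z \<notin> S" by metis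
    then show ?thesis
      using S X_measurable that by (subst (asm) AE_distr_iff) (auto simp: null_sets_def)
  qed
  then have "AE \<omega> in M. \<forall>p\<in>{1..N}. X p \<omega> \<notin> S" by (intro AE_finite_allI) auto
  then show "AE \<omega> in M. order_stat X k N \<omega> \<notin> S"
    by eventually_elim (metis order_stat_in_sample[OF assms])
qed

lemma order_stat_ordered_by_inj:
  assumes "ys \<in> permutations_of_set {1..N}" "ordered_by ys \<omega>"
    and "1 \<le> k" "k \<le> N" "1 \<le> l" "l \<le> N" "order_stat X k N \<omega> = order_stat X l N \<omega>"
  shows "k = l"
proof -
  have "distinct (map (\<lambda>p. X p \<omega>) ys)" using assms(2) unfolding ordered_by_def strict_sorted_iff by simp
  moreover have len: "length ys = N" using length_finite_permutations_of_set[OF assms(1)] by simp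
  moreover have "map (\<lambda>p. X p \<omega>) ys ! (k - 1) = map (\<lambda>p. X p \<omega>) ys ! (l - 1)"
    using order_stat_ordered_by[OF assms(1,2)] assms(3-7) len by simp
  ultimately have "k - 1 = l - 1" using assms(3-6) by (subst (asm) nth_eq_iff_index_eq) auto
  then show ?thesis using assms by simp
qed

lemma AE_order_stat_distinct:
  assumes "1 \<le> k" "k \<le> N" "1 \<le> l" "l \<le> N" "k \<noteq> l"
  shows "AE \<omega> in M. order_stat X k N \<omega> \<noteq> order_stat X l N \<omega>"
  using AE_ordered_by[of N] by (rule eventually_mono) (metis order_stat_ordered_by_inj assms)

lemma order_stat_pair_distributed:
  assumes "1 \<le> k" "k \<le> N" "1 \<le> l" "l \<le> N" "k \<noteq> l"
  shows "\<exists>h. distributed M lborel (\<lambda>\<omega>. (order_stat X k N \<omega>, order_stat X l N \<omega>)) h \<and> (\<forall>s. h (s, s) = 0)"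
proof -
  let ?V = "\<lambda>\<omega>. (order_stat X k N \<omega>, order_stat X l N \<omega>)"
  let ?h = "RN_deriv lborel (distr M lborel ?V)"
  let ?D = "{z :: real \<times> real. fst z = snd z}"
  have D: "distributed M lborel ?V ?h"
  proof (rule distributed_RN_deriv_lborel)
    show "?V \<in> borel_measurable M" using assms by (intro borel_measurable_Pair order_stat_rv0)
    fix S :: "(real \<times> real) set" assume S: "S \<in> null_sets lborel"
    have "AE \<omega> in M. p \<noteq> q \<longrightarrow> (X p \<omega>, X q \<omega>) \<notin> S" if "p \<in> {1..N}" "q \<in> {1..N}" for p q
      using AE_pair[OF _ _ _ S, of p q] that by (cases "p = q") auto
    then have "AE \<omega> in M. \<forall>p\<in>{1..N}. \<forall>q\<in>{1..N}. p \<noteq> q \<longrightarrow> (X p \<omega>, X q \<omega>) \<notin> S"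
      by (intro AE_finite_allI) auto
    \<comment> \<open>The two order statistics are almost surely different, so they are observations
      with different indices p and q, and the bound for such pairs applies.\<close>
    then show "AE \<omega> in M. ?V \<omega> \<notin> S" using AE_order_stat_distinct[OF assms]
      by eventually_elim (metis order_stat_in_sample[OF assms(1,2)] order_stat_in_sample[OF assms(3,4)])
  qed
  have mD: "?D \<in> sets borel" using null_sets_diagonal by (simp add: null_sets_def)
  have mh: "?h \<in> borel_measurable lborel" by simp
  \<comment> \<open>The Radon-Nikodym derivative is fixed only up to null sets; setting it to 0 on
    the diagonal gives the required version.\<close>
  have mh': "(\<lambda>z. if z \<in> ?D then 0 else ?h z) \<in> borel_measurable lborel"
    using mD by (intro measurable_If_set) auto
  have "density lborel ?h = density lborel (\<lambda>z. if z \<in> ?D then 0 else ?h z)"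
    using AE_not_in[OF null_sets_diagonal] mh mh'
    by (intro density_cong) (auto elim!: eventually_mono)
  then have "distributed M lborel ?V (\<lambda>z. if z \<in> ?D then 0 else ?h z)"
    using D mh' by (simp add: distributed_def)
  then show ?thesis by (intro exI[of _ "\<lambda>z. if z \<in> ?D then 0 else ?h z"]) auto
qed

text \<open>Ensures that the density formula, stated for arbitrary versions g and h, is not
  vacuous.\<close>

lemma order_stat_densities_exist: "\<exists>g h. order_stat_densities M X N g h"
proof -
  have "\<forall>k l. \<exists>h. k \<in> {1..N} \<longrightarrow> l \<in> {1..N} \<longrightarrow> k \<noteq> l \<longrightarrow>
    distributed M lborel (\<lambda>\<omega>. (order_stat X k N \<omega>, order_stat X l N \<omega>)) h \<and> (\<forall>s. h (s, s) = 0)"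
    using order_stat_pair_distributed[of _ N] by (metis atLeastAtMost_iff)
  then obtain h where "\<forall>k l. k \<in> {1..N} \<longrightarrow> l \<in> {1..N} \<longrightarrow> k \<noteq> l \<longrightarrow>
    distributed M lborel (\<lambda>\<omega>. (order_stat X k N \<omega>, order_stat X l N \<omega>)) (h k l) \<and> (\<forall>s. h k l (s, s) = 0)"
    by metis
  then have "order_stat_densities M X N (\<lambda>k. RN_deriv lborel (distr M lborel (order_stat X k N))) h"
    unfolding order_stat_densities_def using order_stat_distributed[of _ N] by auto
  then show ?thesis by blast
qed

section \<open>Decomposition of the law of the overlapping order statistics\<close>

text \<open>An order statistic of a subsample is an observation, every observation appears among the
  order statistics of the full sample, and these are pairwise different.\<close>

lemma unique_ranks:
  assumes r: "r < m" "m \<le> n" and i: "1 \<le> i" "i \<le> m" and j: "1 \<le> j" "j \<le> n"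
    and ys: "ys \<in> permutations_of_set {1..n + r}" and o: "ordered_by ys \<omega>"
  shows "\<exists>!kl\<in>{1..n + r} \<times> {1..n + r}.
    order_stat X i m \<omega> = order_stat X (fst kl) (n + r) \<omega> \<and>
    shifted_order_stat X r j n \<omega> = order_stat X (snd kl) (n + r) \<omega>"
proof -
  let ?N = "n + r"
  let ?v = "\<lambda>k. order_stat X k ?N \<omega>"
  have len: "length ys = ?N" by (simp add: length_finite_permutations_of_set[OF ys])
  have ex: "\<exists>k\<in>{1..?N}. X p \<omega> = ?v k" if "p \<in> {1..?N}" for p
  proof -
    have "p \<in> set ys" using that permutations_of_setD(1)[OF ys] by blast
    then obtain a where a: "a < ?N" "ys ! a = p" unfolding in_set_conv_nth len by blast
    then have "X p \<omega> = ?v (Suc a)" using order_stat_ordered_by[OF ys o, of "Suc a"] by simp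
    then show ?thesis using a(1) by (intro bexI[of _ "Suc a"]) simp_all
  qed
  have inj: "k = l" if "k \<in> {1..?N}" "l \<in> {1..?N}" "?v k = ?v l" for k l
    using that by (intro order_stat_ordered_by_inj[OF ys o]) simp_all
  obtain p where p: "p \<in> {1..m}" "order_stat X i m \<omega> = X p \<omega>" using order_stat_in_sample[OF i, where X = X and \<omega> = \<omega>] by blast
  have "p \<in> {1..?N}" using p(1) r by simp
  then obtain k where k: "k \<in> {1..?N}" "order_stat X i m \<omega> = ?v k"
    using ex[of p] p(2) by metis
  obtain q where q: "q \<in> {1..n}" "shifted_order_stat X r j n \<omega> = X (r + q) \<omega>"
    using order_stat_in_sample[OF j, where X = "\<lambda>p. X (r + p)" and \<omega> = \<omega>] by blast
  have "r + q \<in> {1..?N}" using q(1) by simp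
  then obtain l where l: "l \<in> {1..?N}" "shifted_order_stat X r j n \<omega> = ?v l"
    using ex[of "r + q"] q(2) by metis
  show ?thesis
  proof (rule ex1I)
    show "(k, l) \<in> {1..?N} \<times> {1..?N} \<and> order_stat X i m \<omega> = ?v (fst (k, l)) \<and>
      shifted_order_stat X r j n \<omega> = ?v (snd (k, l))" using k l by simp
  next
    fix kl assume kl: "kl \<in> {1..?N} \<times> {1..?N} \<and> order_stat X i m \<omega> = ?v (fst kl) \<and>
      shifted_order_stat X r j n \<omega> = ?v (snd kl)"
    have "fst kl = k" using kl k by (intro inj) (simp_all add: mem_Times_iff)
    moreover have "snd kl = l" using kl l by (intro inj) (simp_all add: mem_Times_iff)
    ultimately show "kl = (k, l)" by (simp add: prod_eq_iff)
  qed
qed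

text \<open>The rank pairs (k, l) partition the space almost surely, and \<open>prob_ranks\<close>
  factorises the probability on each part.\<close>

lemma prob_overlapping:
  fixes S :: "(real \<times> real) set"
  assumes r: "r < m" "m \<le> n" and i: "1 \<le> i" "i \<le> m" and j: "1 \<le> j" "j \<le> n"
    and S: "S \<in> sets borel"
  shows "\<P>(\<omega> in M. (order_stat X i m \<omega>, shifted_order_stat X r j n \<omega>) \<in> S) =
    (\<Sum>k=1..n + r. \<Sum>l=1..n + r. coef M X r i m k j n l *
       \<P>(\<omega> in M. (order_stat X k (n + r) \<omega>, order_stat X l (n + r) \<omega>) \<in> S))"
proof -
  let ?N = "n + r"
  let ?I = "{1..?N} \<times> {1..?N}"
  let ?V = "\<lambda>k l \<omega>. (order_stat X k ?N \<omega>, order_stat X l ?N \<omega>)"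
  let ?Z = "\<lambda>\<omega>. (order_stat X i m \<omega>, shifted_order_stat X r j n \<omega>)"
  let ?E = "\<lambda>k l \<omega>. order_stat X i m \<omega> = order_stat X k (n + r) \<omega> \<and>
      shifted_order_stat X r j n \<omega> = order_stat X l (n + r) \<omega>"
  let ?p = "\<lambda>k l. coef M X r i m k j n l"
  have [measurable]: "order_stat X i m \<in> borel_measurable M" "shifted_order_stat X r j n \<in> borel_measurable M"
    using i j by (simp_all add: order_stat_rv0 order_stat_rv)
  have rvV: "order_stat X k ?N \<in> borel_measurable M" if "k \<in> {1..?N}" for k
    using that by (simp add: order_stat_rv0)
  have [measurable]: "S \<in> sets (borel \<Otimes>\<^sub>M borel)" using S unfolding borel_prod .
  have m: "{\<omega> \<in> space M. ?E k l \<omega> \<and> ?V k l \<omega> \<in> S} \<in> events" if "k \<in> {1..?N}" "l \<in> {1..?N}" for k l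
  proof -
    note [measurable] = rvV[OF that(1)] rvV[OF that(2)]
    show ?thesis by measurable
  qed
  have "\<P>(\<omega> in M. ?Z \<omega> \<in> S) = (\<Sum>kl\<in>?I. \<P>(\<omega> in M. ?E (fst kl) (snd kl) \<omega> \<and> ?V (fst kl) (snd kl) \<omega> \<in> S))"
  proof (rule prob_sum)
    show "AE \<omega> in M. (\<forall>kl\<in>?I. ?E (fst kl) (snd kl) \<omega> \<and> ?V (fst kl) (snd kl) \<omega> \<in> S \<longrightarrow> ?Z \<omega> \<in> S) \<and>
       (?Z \<omega> \<in> S \<longrightarrow> (\<exists>!kl\<in>?I. ?E (fst kl) (snd kl) \<omega> \<and> ?V (fst kl) (snd kl) \<omega> \<in> S))"
      using AE_ordered_by[of ?N]
    proof eventually_elim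
      case (elim \<omega>)
      then obtain ys where "ys \<in> permutations_of_set {1..?N}" "ordered_by ys \<omega>" by blast
      note unique = unique_ranks[OF r i j this]
      \<comment> \<open>Under \<open>?E k l\<close> the two random vectors coincide, so the
        condition on S may be read for either of them.\<close>
      have eq: "?E k l \<omega> \<and> ?V k l \<omega> \<in> S \<longleftrightarrow> ?E k l \<omega> \<and> ?Z \<omega> \<in> S" for k l by auto
      show ?case
      proof (cases "?Z \<omega> \<in> S")
        case True
        show ?thesis unfolding eq using unique by (simp only: True simp_thms ball_triv)
      next
        case False
        then show ?thesis unfolding eq by (simp only: simp_thms ball_triv)
      qed
    qed
    show "{\<omega> \<in> space M. ?Z \<omega> \<in> S} \<in> events" by measurable
  qed (use m in auto)
  also have "\<dots> = (\<Sum>kl\<in>?I. ?p (fst kl) (snd kl) * \<P>(\<omega> in M. ?V (fst kl) (snd kl) \<omega> \<in> S))"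
    using prob_ranks[OF r i j _ _ _ _ S] coef_eq[OF r i j] by (intro sum.cong refl) auto
  finally show ?thesis
    by (simp add: sum.cartesian_product case_prod_unfold)
qed

text \<open>It suffices to compare both measures on every Borel set S. The mixture of laws turns
  into the integral of the mixture of densities by exchanging finite sums with the integral over
  \<open>nu\<close>.\<close>

lemma distributed_overlapping:
  assumes r: "r < m" "m \<le> n" and i: "1 \<le> i" "i \<le> m" and j: "1 \<le> j" "j \<le> n"
    and d: "order_stat_densities M X (n + r) g h"
  shows "distributed M nu (\<lambda>\<omega>. (order_stat X i m \<omega>, shifted_order_stat X r j n \<omega>))
          (\<lambda>(x, y). \<Sum>k=1..n + r. \<Sum>l=1..n + r.
             ennreal (coef M X r i m k j n l) * joint_density g h k l x y)"
proof -
  let ?N = "n + r"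
  let ?V = "\<lambda>k l \<omega>. (order_stat X k ?N \<omega>, order_stat X l ?N \<omega>)"
  let ?Z = "\<lambda>\<omega>. (order_stat X i m \<omega>, shifted_order_stat X r j n \<omega>)"
  let ?p = "\<lambda>k l. coef M X r i m k j n l"
  let ?F = "\<lambda>z. case z of (x, y) \<Rightarrow> \<Sum>k=1..n + r. \<Sum>l=1..n + r. ennreal (?p k l) * joint_density g h k l x y"
  let ?J = "\<lambda>k l z. case z of (x, y) \<Rightarrow> joint_density g h k l x y"
  have rvZ[measurable]: "order_stat X i m \<in> borel_measurable M" "shifted_order_stat X r j n \<in> borel_measurable M"
    using i j by (simp_all add: order_stat_rv0 order_stat_rv)
  have Zm: "?Z \<in> measurable M nu"
    using borel_measurable_Pair[OF rvZ] by (simp cong: measurable_cong_sets)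
  have Jm: "?J k l \<in> borel_measurable nu" if "k \<in> {1..?N}" "l \<in> {1..?N}" for k l
    using joint_density_measurable[OF d that] by (simp cong: measurable_cong_sets)
  have F: "?F = (\<lambda>z. \<Sum>k=1..n + r. \<Sum>l=1..n + r. ennreal (?p k l) * ?J k l z)"
    by (auto simp: fun_eq_iff)
  have Fm: "?F \<in> borel_measurable nu"
    unfolding F by (intro borel_measurable_sum borel_measurable_times_ennreal borel_measurable_const Jm) auto
  have "distr M nu ?Z = density nu ?F"
  proof (rule measure_eqI)
    fix S assume "S \<in> sets (distr M nu ?Z)"
    then have S: "S \<in> sets borel" by simp
    note prob = prob_overlapping[OF r i j S]
    have "emeasure (distr M nu ?Z) S = ennreal (\<P>(\<omega> in M. ?Z \<omega> \<in> S))"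
      using S Zm by (simp add: emeasure_distr emeasure_eq_measure vimage_def Int_def conj_commute)
    also have "\<dots> = (\<Sum>k=1..?N. \<Sum>l=1..?N. ennreal (?p k l) * ennreal (\<P>(\<omega> in M. ?V k l \<omega> \<in> S)))"
      unfolding prob by (subst sum_ennreal[symmetric], simp add: sum_nonneg coef_def)+
        (intro sum.cong refl ennreal_mult; simp add: coef_def)
    also have "\<dots> = (\<Sum>k=1..?N. \<Sum>l=1..?N. \<integral>\<^sup>+z. ennreal (?p k l) * (?J k l z * indicator S z) \<partial>nu)"
    proof (intro sum.cong refl)
      fix k l assume kl: "k \<in> {1..?N}" "l \<in> {1..?N}"
      have "(\<lambda>z. ?J k l z * indicator S z) \<in> borel_measurable nu"
        using Jm[OF kl] S by (intro borel_measurable_times_ennreal borel_measurable_indicator) auto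
      then show "ennreal (?p k l) * ennreal (\<P>(\<omega> in M. ?V k l \<omega> \<in> S)) =
        (\<integral>\<^sup>+z. ennreal (?p k l) * (?J k l z * indicator S z) \<partial>nu)"
        using nn_integral_joint_density[OF d kl S] by (simp add: nn_integral_cmult emeasure_eq_measure)
    qed
    also have "\<dots> = (\<integral>\<^sup>+z. (\<Sum>k=1..?N. \<Sum>l=1..?N. ennreal (?p k l) * (?J k l z * indicator S z)) \<partial>nu)"
    proof -
      have m: "(\<lambda>z. ennreal (?p k l) * (?J k l z * indicator S z)) \<in> borel_measurable nu"
        if "k \<in> {1..?N}" "l \<in> {1..?N}" for k l
        using Jm[OF that] S
        by (intro borel_measurable_times_ennreal borel_measurable_indicator borel_measurable_const) simp_all
      have "(\<Sum>k=1..?N. \<Sum>l=1..?N. \<integral>\<^sup>+z. ennreal (?p k l) * (?J k l z * indicator S z) \<partial>nu) =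
        (\<Sum>k=1..?N. \<integral>\<^sup>+z. (\<Sum>l=1..?N. ennreal (?p k l) * (?J k l z * indicator S z)) \<partial>nu)"
        by (intro sum.cong refl nn_integral_sum[symmetric] m)
      also have "\<dots> = (\<integral>\<^sup>+z. (\<Sum>k=1..?N. \<Sum>l=1..?N. ennreal (?p k l) * (?J k l z * indicator S z)) \<partial>nu)"
        by (intro nn_integral_sum[symmetric] borel_measurable_sum m)
      finally show ?thesis .
    qed
    also have "\<dots> = (\<integral>\<^sup>+z. ?F z * indicator S z \<partial>nu)"
      unfolding F by (simp add: sum_distrib_right mult.assoc)
    also have "\<dots> = emeasure (density nu ?F) S"
      using S Fm by (simp add: emeasure_density)
    finally show "emeasure (distr M nu ?Z) S = emeasure (density nu ?F) S" .
  qed simp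
  then show ?thesis unfolding distributed_def using Fm Zm by blast
qed

end

theorem theorem2p5:
  fixes M :: "'a measure" and X :: "nat \<Rightarrow> 'a \<Rightarrow> real" and f :: "real \<Rightarrow> ennreal"
    and r m n i j :: nat
  assumes "prob_space M"
    and "prob_space.indep_vars M (\<lambda>_. borel) X {1..}"
    and "\<And>p. p \<ge> 1 \<Longrightarrow> distributed M lborel (X p) f"
    and "r < m" and "m \<le> n"
    and "1 \<le> i" and "i \<le> m" and "1 \<le> j" and "j \<le> n"
  defines "p \<equiv> \<lambda>k l. coef M X r i m k j n l"
    and "A \<equiv> r" and "B \<equiv> m - r" and "C \<equiv> n + r - m"
  shows
    "(\<exists>g h. order_stat_densities M X (n + r) g h) \<and>
     (\<forall>g h. order_stat_densities M X (n + r) g h \<longrightarrow>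
        distributed M nu (\<lambda>\<omega>. (order_stat X i m \<omega>, shifted_order_stat X r j n \<omega>))
          (\<lambda>(x, y). \<Sum>k=1..n + r. \<Sum>l=1..n + r.
             ennreal (p k l) * joint_density g h k l x y)) \<and>
     (\<forall>k\<in>{1..n + r}. \<forall>l\<in>{1..n + r}.
        (\<not> (i \<le> k \<and> k \<le> i + n + r - m \<and> j \<le> l \<and> l \<le> j + r) \<longrightarrow> p k l = 0) \<and>
        (k < l \<longrightarrow> p k l =
           (real n - real j + 1) *
             (real A * DD (A - 1) B C (k - 1) (l - k - 1) (int k - int i) (int l - int j - 1) +
              real B * DD A (B - 1) C (k - 1) (l - k - 1) (int k - int i) (int l - int j)) /
           ((real r + real n - real l + 1) * fact (r + n))) \<and>
        (k = l \<longrightarrow> p k l =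
           real B * DD A (B - 1) C (k - 1) 0 (int k - int i) (int k - int j) / fact (r + n)) \<and>
        (k > l \<longrightarrow> p k l =
           (real m - real i + 1) *
             (real C * DD (C - 1) B A (l - 1) (k - l - 1) (int l - int j) (int k - int i - 1) +
              real B * DD C (B - 1) A (l - 1) (k - l - 1) (int l - int j) (int k - int i)) /
           ((real r + real n - real k + 1) * fact (r + n))))"
proof -
  interpret prob_space M by fact
  interpret iid_density M X f
    using assms(2,3) by unfold_locales
  let ?A = "{1..r}" and ?B = "{r + 1..m}" and ?C = "{m + 1..n + r}"
  note rm = assms(4,5) and i = assms(6,7) and j = assms(8,9)
  have fin: "finite ?A" "finite ?B" "finite ?C" by simp_all
  have disj: "?A \<inter> ?B = {}" "?A \<inter> ?C = {}" "?B \<inter> ?C = {}" using rm by auto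
  have card: "card ?A = A" "card ?B = B" "card ?C = C" by (simp_all add: A_def B_def C_def)
  \<comment> \<open>These sums turn the counts of choices for the later entry into n - j + 1 and m -
    i + 1: B \<union> C has n indices and A \<union> B has m.\<close>
  have sums: "A + B + C = n + r" "B + C = n" "A + B = m" using rm by (simp_all add: A_def B_def C_def)
  have p: "p k l = real (card (rank_lists ?A ?B ?C i k j l)) / fact (n + r)"
    if "k \<in> {1..n + r}" "l \<in> {1..n + r}" for k l
    using coef_eq[OF rm i j, of k l] that unfolding p_def by simp
  have bounds: "p k l = 0" if kl: "k \<in> {1..n + r}" "l \<in> {1..n + r}"
    and "\<not> (i \<le> k \<and> k \<le> i + n + r - m \<and> j \<le> l \<and> l \<le> j + r)" for k l
  proof -
    have "rank_lists ?A ?B ?C i k j l = {}"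
    proof (rule ccontr)
      assume "rank_lists ?A ?B ?C i k j l \<noteq> {}"
      then obtain xs where xs: "xs \<in> rank_lists ?A ?B ?C i k j l" by blast
      have "1 \<le> k" "k \<le> card ?A + card ?B + card ?C" "1 \<le> l" "l \<le> card ?A + card ?B + card ?C"
        unfolding card sums(1) using kl by simp_all
      from rank_lists_bounds[OF fin disj i(1) j(1) this xs]
      have "i \<le> k \<and> k \<le> i + C \<and> j \<le> l \<and> l \<le> j + A" unfolding card .
      moreover have "i + C = i + n + r - m" using rm unfolding C_def by linarith
      ultimately show False using that(3) unfolding A_def by simp
    qed
    then show ?thesis using p[OF kl] by simp
  qed
  have less: "p k l = (real n - real j + 1) *
        (real A * DD (A - 1) B C (k - 1) (l - k - 1) (int k - int i) (int l - int j - 1) +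
         real B * DD A (B - 1) C (k - 1) (l - k - 1) (int k - int i) (int l - int j)) /
        ((real r + real n - real l + 1) * fact (r + n))"
    if "k \<in> {1..n + r}" "l \<in> {1..n + r}" "k < l" for k l
    using card_rank_lists_less[OF fin disj card i(1) j(1), unfolded sums(1), unfolded sums(2,3), of k l] j(2) that
    unfolding p[OF that(1,2)] by (simp add: add.commute)
  have equal: "p k k = real B * DD A (B - 1) C (k - 1) 0 (int k - int i) (int k - int j) / fact (r + n)"
    if "k \<in> {1..n + r}" for k
    using card_rank_lists_equal[OF fin disj card i(1) j(1), unfolded sums(1), of k] that
    unfolding p[OF that that] by (simp add: add.commute)
  have greater: "p k l = (real m - real i + 1) *
        (real C * DD (C - 1) B A (l - 1) (k - l - 1) (int l - int j) (int k - int i - 1) +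
         real B * DD C (B - 1) A (l - 1) (k - l - 1) (int l - int j) (int k - int i)) /
        ((real r + real n - real k + 1) * fact (r + n))"
    if "k \<in> {1..n + r}" "l \<in> {1..n + r}" "k > l" for k l
    using card_rank_lists_greater[OF fin disj card i(1) j(1), unfolded sums(1), unfolded sums(2,3), of l k] i(2) that
    unfolding p[OF that(1,2)] by (simp add: add.commute)
  have density: "distributed M nu (\<lambda>\<omega>. (order_stat X i m \<omega>, shifted_order_stat X r j n \<omega>))
          (\<lambda>(x, y). \<Sum>k=1..n + r. \<Sum>l=1..n + r. ennreal (p k l) * joint_density g h k l x y)"
    if "order_stat_densities M X (n + r) g h" for g h
    unfolding p_def by (rule distributed_overlapping[OF rm i j that])
  show ?thesis
  proof (intro conjI ballI allI impI)
    show "\<exists>g h. order_stat_densities M X (n + r) g h" by (rule order_stat_densities_exist)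
  qed (use density bounds less equal greater in blast)+
qed

end
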